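(* Let $1\le n<N$ be integers, $1\le p<\infty$, and let $\sigma=\{\sigma_i\}_{i=1}^N$ be a non-increasing sequence of non-negative numbers with associated $p$-ellipsoid $\mathcal{E}_p\subset\mathbb{R}^N$. For every $t>0$, with probability at least $$1-e^{-n/8}-e^{-t^2/2}$$ the following holds. If $2\le p<\infty$, $$\mathcal{R}_n(\mathcal{E}_p)\ge\frac{\sqrt n}{2\left(\sqrt p\left(\sum_{i=1}^{n+1}\frac{1}{\sigma_i^p}\right)^{1/p}+\frac{t}{\sigma_{n+1}}\right)}.$$ If $1\le p<2$, $$\mathcal{R}_n(\mathcal{E}_p)\ge\frac{\sqrt n}{2\left(\left(\sum_{i=1}^{n+1}\frac{1}{\sigma_i^p}\right)^{1/p}+t\left(\sum_{i=1}^{n+1}\frac{1}{\sigma_i^{2p/(2-p)}}\right)^{1/p-1/2}\right)}.$$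
   Context: $\mathcal{E}_p=\{x\in\mathbb{R}^N:\sum_{i=1}^N(|x_i|/\sigma_i)^p\le1\}$ (if $\sigma_i=0$ the condition is understood as $x_i=0$; with $1/0=\infty$ and $1/\infty=0$ the bounds are then trivial when $\sigma_{n+1}=0$). The $n$-th random radius is $\mathcal{R}_n(\mathcal{E}_p)=\max_{y\in E_n\cap\mathcal{E}_p}|y|$, where $|\cdot|$ is the Euclidean norm and $E_n$ is a random $n$-codimensional linear subspace of $\mathbb{R}^N$ distributed according to the normalized Haar measure on the Grassmannian; probability is with respect to $E_n$. *)

theory Defs
  imports "HOL-Probability.Probability"
begin

(* Meant for a > 0, where \<infinity> powr a = \<infinity>. *)
definition ennreal_powr :: "ennreal \<Rightarrow> real \<Rightarrow> ennreal"  (infixr \<open>epowr\<close> 80)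
  where "x epowr a = (if x = \<infinity> then \<infinity> else ennreal (enn2real x powr a))"

(* For s i = 0 the summand vanishes because x / 0 = 0 in HOL;
   the first conjunct expresses the intended constraint x $ i = 0. *)
definition p_ellipsoid :: "real \<Rightarrow> ('N::finite \<Rightarrow> real) \<Rightarrow> (real ^ 'N) set"
  where "p_ellipsoid p s =
    {x. (\<forall>i. s i = 0 \<longrightarrow> x $ i = 0) \<and> (\<Sum>i\<in>UNIV. (\<bar>x $ i\<bar> / s i) powr p) \<le> 1}"

(* The supremum is a maximum for the compact sets K considered here, see
   section_radius_attained below. *)
definition section_radius :: "(real ^ 'N) set \<Rightarrow> (real ^ 'N) set \<Rightarrow> real"
  where "section_radius E K = (SUP y\<in>E \<inter> K. norm y)"

(* For a subspace E, closest_point E is the orthogonal projection onto E. The usual topology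
   of the Grassmannian is the one induced by identifying E with the matrix of this projection,
   and its Borel sets are the preimages of Borel sets of matrices. *)
definition grassmannian :: "nat \<Rightarrow> (real ^ 'N) set measure"
  where "grassmannian k =
    vimage_algebra {E. subspace E \<and> dim E = k} (\<lambda>E. matrix (closest_point E)) borel"

(* The normalized Haar measure: the Borel probability measure on the Grassmannian that is
   invariant under the action of the orthogonal group. *)
definition grassmann_haar :: "nat \<Rightarrow> (real ^ 'N) set measure \<Rightarrow> bool"
  where "grassmann_haar k \<mu> \<longleftrightarrow>
    prob_space \<mu> \<and> sets \<mu> = sets (grassmannian k) \<and>
    (\<forall>Q. orthogonal_transformation Q \<longrightarrow>
      (\<forall>A\<in>sets \<mu>. emeasure \<mu> ((\<lambda>E. Q ` E) ` A) = emeasure \<mu> A))"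

lemma compact_p_ellipsoid:
  fixes s :: "'N::finite \<Rightarrow> real"
  assumes p: "p \<ge> 1" and s: "\<And>i. s i \<ge> 0"
  shows "compact (p_ellipsoid p s)"
proof -
  have cont: "continuous_on UNIV (\<lambda>x::real^'N. (\<bar>x $ i\<bar> / s i) powr p)" for i
    using p s by (cases "s i = 0") (auto intro!: continuous_intros continuous_on_powr')
  have eq: "p_ellipsoid p s = (\<Inter>i\<in>{i. s i = 0}. {x. x $ i = 0}) \<inter>
      {x. (\<Sum>i\<in>UNIV. (\<bar>x $ i\<bar> / s i) powr p) \<le> 1}"
    by (auto simp: p_ellipsoid_def)
  have "closed (p_ellipsoid p s)"
    unfolding eq
    by (intro closed_Int closed_INT ballI closed_Collect_eq closed_Collect_le
        continuous_intros continuous_on_sum cont)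
  moreover have "\<bar>x $ i\<bar> \<le> s i" if x: "x \<in> p_ellipsoid p s" for x i
  proof (cases "s i = 0")
    case False
    then have si: "s i > 0" using s[of i] by simp
    have "(\<bar>x $ i\<bar> / s i) powr p \<le> (\<Sum>i\<in>UNIV. (\<bar>x $ i\<bar> / s i) powr p)"
      by (rule member_le_sum) auto
    also have "\<dots> \<le> 1" using x by (simp add: p_ellipsoid_def)
    finally have "\<not> \<bar>x $ i\<bar> / s i > 1"
      using p gr_one_powr[of "\<bar>x $ i\<bar> / s i" p] by linarith
    then show ?thesis using si by (simp add: field_simps not_less)
  qed (use x in \<open>auto simp: p_ellipsoid_def\<close>)
  then have "p_ellipsoid p s \<subseteq> cball 0 (\<Sum>i\<in>UNIV. s i)"
    by (auto intro!: order_trans[OF norm_le_l1_cart] sum_mono)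
  then have "bounded (p_ellipsoid p s)"
    using bounded_cball bounded_subset by blast
  ultimately show ?thesis by (simp add: compact_eq_bounded_closed)
qed

lemma section_radius_attained:
  fixes s :: "'N::finite \<Rightarrow> real"
  assumes p: "p \<ge> 1" and s: "\<And>i. s i \<ge> 0" and E: "subspace E"
  shows "\<exists>y\<in>E \<inter> p_ellipsoid p s. norm y = section_radius E (p_ellipsoid p s) \<and>
           (\<forall>z\<in>E \<inter> p_ellipsoid p s. norm z \<le> norm y)"
proof -
  let ?K = "E \<inter> p_ellipsoid p s"
  have "compact ?K"
    by (rule closed_Int_compact[OF closed_subspace[OF E] compact_p_ellipsoid]) (use p s in auto)
  moreover have "0 \<in> ?K"
    using E by (simp add: subspace_0 p_ellipsoid_def)
  ultimately obtain y where y: "y \<in> ?K" "\<forall>z\<in>?K. norm z \<le> norm y"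
    using continuous_attains_sup[of ?K norm] by (force intro: continuous_intros)
  then have "section_radius E (p_ellipsoid p s) = norm y"
    unfolding section_radius_def by (intro cSup_eq_maximum) auto
  with y show ?thesis by auto
qed

end

theory Submission
  imports Defs "HOL-Real_Asymp.Real_Asymp"
begin

text \<open>
  Let \<open>F\<close> be the span of the first \<open>n + 1\<close> coordinate vectors and let
  \<open>f x = (\<Sum>i\<le>n+1. (\<bar>x i\<bar> / \<sigma> i) powr p) powr (1/p)\<close>. A subspace \<open>E\<close> of codimension \<open>n\<close> contains a
  nonzero \<open>y \<in> F\<close>, and rescaling \<open>y\<close> to the boundary of the ellipsoid shows that the radius of the
  section is at least \<open>norm y / f y\<close>. This ratio depends on the direction of \<open>y\<close> only, and rotation
  invariance makes that direction at least as good as the direction of a standard Gaussian vector \<open>g\<close>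
  of \<open>F\<close>. So it suffices to bound \<open>norm g / f g\<close> from below.

  The numerator is at least \<open>sqrt n / 2\<close> outside an event of probability \<open>exp (- n / 8)\<close>
  (\<open>gaussian_L2_lower_tail\<close>, an exponential Markov bound). The denominator \<open>f\<close> is a norm. Its
  Lipschitz constant \<open>L\<close> for the Euclidean norm is at most \<open>1 / \<sigma> (n+1)\<close> if \<open>p \<ge> 2\<close>, and Hoelder's
  inequality gives the constant of the statement if \<open>p < 2\<close>; its mean is at most the \<open>p\<close>-th root of the mean of \<open>f g powr p\<close>, which
  splits into the \<open>p\<close>-th absolute moment of one normal variable and \<open>\<Sum>i\<le>n+1. 1 / \<sigma> i powr p\<close>. Gaussian concentration
  (\<open>gaussian_concentration\<close>) yields \<open>f g < mean + t * L\<close> outside an event of probability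
  \<open>exp (- t\<^sup>2 / 2)\<close>. If \<open>\<sigma> (n+1) = 0\<close>, the bound is \<open>0\<close>.

  Two ingredients carry the weight.

  Concentration with the sharp constant follows from the dual form of Talagrand's transport
  inequality for Lipschitz functions: if \<open>u x \<le> \<phi> y + (dist x y)\<^sup>2 / 2\<close> for all \<open>x\<close>, \<open>y\<close>, then \<open>\<integral> exp u \<le> exp (\<integral> \<phi>)\<close> for the
  Gaussian measure. For an \<open>L\<close>-Lipschitz \<open>f\<close> the choice \<open>u = c f - c\<^sup>2 L\<^sup>2 / 2\<close>, \<open>\<phi> = c f\<close> turns this
  into the exponential moment bound. On the line the inequality comes from the monotone
  map that transports the normal distribution to the measure with density proportional to \<open>exp u\<close>
  with respect to it
  (\<open>std_normal_transport_normalized\<close>), and it passes to products by integrating out one coordinate at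
  a time (\<open>gaussian_product_infconv\<close>).

  The comparison of a Haar distributed subspace with a Gaussian vector
  (\<open>grassmann_haar_section_le_gaussian\<close>) uses the invariance of the two measures directly, without
  choosing a vector of \<open>E \<inter> F\<close> measurably: one integrates, in both orders, a kernel that
  relates \<open>E\<close> to the vectors whose direction is close to \<open>E \<inter> F\<close>.
\<close>

section \<open>Transport of the normal distribution on the line\<close>

lemma std_normal_times_exp:
  "std_normal_density x * exp (c * x) = exp (c\<^sup>2 / 2) * normal_density c 1 x"
  by (simp add: normal_density_def exp_add[symmetric] power2_eq_square field_simps)

lemma integrable_std_normal_exp_abs:
  "integrable std_normal_distribution (\<lambda>x. exp (c * \<bar>x\<bar>))"
proof -
  have *: "integrable std_normal_distribution (\<lambda>x. exp (d * x))" for d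
    by (subst integrable_density) (auto simp: std_normal_times_exp)
  have "norm (exp (c * \<bar>x\<bar>)) \<le> norm (exp (c * x) + exp (- c * x))" for x
    using exp_gt_zero[of "c * x"] exp_gt_zero[of "- c * x"] by (cases "x < 0") (auto simp del: exp_gt_zero)
  then show ?thesis
    by (intro Bochner_Integration.integrable_bound[OF Bochner_Integration.integrable_add[OF *[of c] *[of "-c"]]])
       auto
qed

lemma lipschitz_abs_imp_continuous:
  fixes u :: "real \<Rightarrow> real"
  assumes "\<And>x y. \<bar>u x - u y\<bar> \<le> K * \<bar>x - y\<bar>"
  shows "continuous_on UNIV u"
proof -
  have "K \<ge> 0" using assms[of 0 1] by auto
  then have "lipschitz_on K UNIV u"
    using assms by (auto simp: lipschitz_on_def dist_real_def)
  then show ?thesis by (rule lipschitz_on_continuous_on)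
qed

lemma lipschitz_integrable_std_normal:
  fixes u :: "real \<Rightarrow> real"
  assumes lip: "\<And>x y. \<bar>u x - u y\<bar> \<le> K * \<bar>x - y\<bar>"
  shows "integrable std_normal_distribution u"
    and "integrable std_normal_distribution (\<lambda>x. exp (u x))"
    and "integrable std_normal_distribution (\<lambda>x. x\<^sup>2 * exp (u x))"
proof -
  have [measurable]: "u \<in> borel_measurable borel"
    by (rule borel_measurable_continuous_onI) (rule lipschitz_abs_imp_continuous[OF lip])
  have K: "K \<ge> 0" using lip[of 0 1] by auto
  have ub: "u x \<le> u 0 + K * \<bar>x\<bar>" "\<bar>u x\<bar> \<le> \<bar>u 0\<bar> + K * \<bar>x\<bar>" for x using lip[of x 0] by auto
  have eb: "\<bar>x\<bar> \<le> exp \<bar>x\<bar>" for x :: real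
    using exp_ge_add_one_self[of "\<bar>x\<bar>"] by linarith
  show "integrable std_normal_distribution (\<lambda>x. exp (u x))"
  proof (rule Bochner_Integration.integrable_bound)
    show "integrable std_normal_distribution (\<lambda>x. exp (u 0) * exp (K * \<bar>x\<bar>))"
      using integrable_std_normal_exp_abs by (intro integrable_mult_right) auto
    show "AE x in std_normal_distribution. norm (exp (u x)) \<le> norm (exp (u 0) * exp (K * \<bar>x\<bar>))"
      using ub by (simp add: exp_add[symmetric])
  qed simp
  show "integrable std_normal_distribution u"
  proof (rule Bochner_Integration.integrable_bound)
    show "integrable std_normal_distribution (\<lambda>x. \<bar>u 0\<bar> * exp (0 * \<bar>x\<bar>) + K * exp (1 * \<bar>x\<bar>))"
      by (intro integrable_mult_right Bochner_Integration.integrable_add integrable_std_normal_exp_abs)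
    have "\<bar>u x\<bar> \<le> \<bar>u 0\<bar> + K * exp \<bar>x\<bar>" for x
      using ub(2)[of x] mult_left_mono[OF eb K, of x] by linarith
    then show "AE x in std_normal_distribution. norm (u x) \<le> norm (\<bar>u 0\<bar> * exp (0 * \<bar>x\<bar>) + K * exp (1 * \<bar>x\<bar>))"
      using K by simp
  qed simp
  show "integrable std_normal_distribution (\<lambda>x. x\<^sup>2 * exp (u x))"
  proof (rule Bochner_Integration.integrable_bound)
    show "integrable std_normal_distribution (\<lambda>x. exp (u 0) * exp ((K + 2) * \<bar>x\<bar>))"
      using integrable_std_normal_exp_abs by (intro integrable_mult_right) auto
    have "x\<^sup>2 * exp (u x) \<le> exp (u 0) * exp ((K + 2) * \<bar>x\<bar>)" for x
    proof -
      have "x\<^sup>2 * exp (u x) \<le> (exp \<bar>x\<bar>)\<^sup>2 * exp (u 0 + K * \<bar>x\<bar>)"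
        using power_mono[OF eb[of x], of 2] ub(1)[of x] by (intro mult_mono) auto
      also have "\<dots> = exp (u 0) * exp ((K + 2) * \<bar>x\<bar>)"
        by (simp add: exp_add[symmetric] power2_eq_square algebra_simps)
      finally show ?thesis .
    qed
    then show "AE x in std_normal_distribution. norm (x\<^sup>2 * exp (u x)) \<le> norm (exp (u 0) * exp ((K + 2) * \<bar>x\<bar>))"
      by simp
  qed simp
qed

lemma cdf_density_has_derivative:
  fixes d :: "real \<Rightarrow> real"
  assumes d: "continuous_on UNIV d" "\<And>x. 0 \<le> d x"
    and "prob_space (density lborel d)"
  shows "(cdf (density lborel d) has_real_derivative d x) (at x)"
proof -
  interpret prob_space "density lborel d" by fact
  interpret real_distribution "density lborel d" by standard auto
  have [measurable]: "d \<in> borel_measurable borel"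
    using d(1) by (rule borel_measurable_continuous_onI)
  have eq: "cdf (density lborel d) y = cdf (density lborel d) (x - 1) + integral {x - 1..y} d"
    if "y \<in> {x - 1..x + 1}" for y
  proof -
    have i: "set_integrable lborel {x - 1..y} d"
      using d(1) by (intro borel_integrable_atLeastAtMost') (auto intro: continuous_on_subset)
    have "measure (density lborel d) {x - 1<..y} = measure (density lborel d) {x - 1..y}"
    proof -
      have "AE z in lborel. ennreal (d z) * indicator {x-1<..y} z = ennreal (d z) * indicator {x-1..y} z"
        using AE_lborel_singleton[of "x - 1"] by eventually_elim (simp add: indicator_def)
      then have "emeasure (density lborel d) {x-1<..y} = emeasure (density lborel d) {x-1..y}"
        by (simp add: emeasure_density nn_integral_cong_AE)
      then show ?thesis by (simp add: measure_def)
    qed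
    also have "\<dots> = (LINT z:{x - 1..y}|lborel. d z)"
    proof -
      have "emeasure (density lborel d) {x - 1..y} = (\<integral>\<^sup>+ z. ennreal (indicator {x - 1..y} z *\<^sub>R d z) \<partial>lborel)"
        by (subst emeasure_density) (auto intro!: nn_integral_cong simp: indicator_def)
      also have "\<dots> = ennreal (LINT z:{x - 1..y}|lborel. d z)"
        unfolding set_lebesgue_integral_def using i d(2)
        by (intro nn_integral_eq_integral) (auto simp: set_integrable_def)
      finally show ?thesis
        using d(2) unfolding set_lebesgue_integral_def
        by (simp add: measure_def)
    qed
    also have "\<dots> = integral {x - 1..y} d"
      using i by (rule set_borel_integral_eq_integral)
    finally show ?thesis
      using cdf_diff_eq[of "x - 1" y] that by (cases "y = x - 1") auto
  qed
  have "((\<lambda>y. cdf (density lborel d) (x - 1) + integral {x - 1..y} d) has_real_derivative 0 + d x)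
      (at x within {x - 1..x + 1})"
    using d(1) by (intro DERIV_add DERIV_const integral_has_real_derivative) (auto intro: continuous_on_subset)
  then have "((\<lambda>y. cdf (density lborel d) (x - 1) + integral {x - 1..y} d) has_real_derivative d x)
      (at x within {x - 1..x + 1})"
    by simp
  then have "(cdf (density lborel d) has_real_derivative d x) (at x within {x - 1..x + 1})"
    by (rule has_field_derivative_transform_within[where d=1]) (auto intro: eq[symmetric])
  then show ?thesis
    by (subst (asm) at_within_Icc_at) auto
qed

text \<open>The map \<open>T\<close> sends quantiles to quantiles: \<open>T = S \<circ> D\<close>, where \<open>D\<close>, \<open>E\<close> are the distribution functions of
  the source and the target and \<open>S\<close> inverts \<open>E\<close>. The formula for its derivative is the change of
  variables \<open>d x = e (T x) * T' x\<close>.\<close>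

lemma exists_monotone_transport:
  fixes d e :: "real \<Rightarrow> real"
  assumes d: "continuous_on UNIV d" "\<And>x. 0 < d x" "prob_space (density lborel d)"
    and e: "continuous_on UNIV e" "\<And>x. 0 < e x" "prob_space (density lborel e)"
  obtains T where "\<And>x. cdf (density lborel e) (T x) = cdf (density lborel d) x"
    and "\<And>x. (T has_real_derivative d x / e (T x)) (at x)"
proof -
  interpret D: prob_space "density lborel d" by fact
  interpret D: real_distribution "density lborel d" by standard auto
  interpret E: prob_space "density lborel e" by fact
  interpret E: real_distribution "density lborel e" by standard auto
  let ?D = "cdf (density lborel d)" and ?E = "cdf (density lborel e)"
  have dD: "(?D has_real_derivative d x) (at x)" for x
    using d by (intro cdf_density_has_derivative) (auto intro: less_imp_le)
  have dE: "(?E has_real_derivative e x) (at x)" for x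
    using e by (intro cdf_density_has_derivative) (auto intro: less_imp_le)
  have monoD: "?D x < ?D y" if "x < y" for x y
    by (rule DERIV_pos_imp_increasing[OF that]) (use dD d(2) in blast)
  have monoE: "?E x < ?E y" if "x < y" for x y
    by (rule DERIV_pos_imp_increasing[OF that]) (use dE e(2) in blast)
  have contE: "isCont ?E x" for x using dE DERIV_isCont by blast
  have injE: "x = y" if "?E x = ?E y" for x y
    using monoE[of x y] monoE[of y x] that by (cases x y rule: linorder_cases) auto
  have "\<exists>y. ?E y = ?D x" for x
  proof -
    have "0 < ?D x" using monoD[of "x - 1" x] D.cdf_nonneg[of "x - 1"] by linarith
    then have "eventually (\<lambda>y. ?E y < ?D x) at_bot"
      using order_tendstoD(2)[OF E.cdf_lim_at_bot] by blast
    then obtain a where a: "?E a < ?D x" by (auto simp: eventually_at_bot_linorder)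
    have "?D x < 1" using monoD[of x "x + 1"] D.cdf_bounded_prob[of "x + 1"] by linarith
    then have "eventually (\<lambda>y. ?D x < ?E y) at_top"
      using order_tendstoD(1)[OF E.cdf_lim_at_top_prob] by blast
    then obtain b where b: "?D x < ?E b" by (auto simp: eventually_at_top_linorder)
    have "a \<le> b" using a b monoE[of b a] by linarith
    with IVT[of ?E a "?D x" b] a b contE show ?thesis by auto
  qed
  then obtain T where T: "\<And>x. ?E (T x) = ?D x" by metis
  define S where "S = inv ?E"
  have SE: "S (?E x) = x" for x
    unfolding S_def by (rule inv_f_f) (auto simp: inj_def intro: injE)
  have TS: "T x = S (?D x)" for x
    using SE[of "T x"] by (simp add: T)
  have dS: "(S has_real_derivative inverse (e z)) (at (?E z))" for z
  proof (rule DERIV_inverse_function[where f="?E" and a="?E (z - 1)" and b="?E (z + 1)"])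
    show "(?E has_real_derivative e z) (at (S (?E z)))" using dE by (simp add: SE)
    show "isCont S (?E z)"
      by (rule isCont_inverse_function2[of "z-1" z "z+1"]) (use SE contE in auto)
    show "?E (S y) = y" if "?E (z - 1) < y" "y < ?E (z + 1)" for y
    proof -
      have "\<exists>w\<ge>z - 1. w \<le> z + 1 \<and> ?E w = y"
        using that contE by (intro IVT) auto
      then obtain w where "?E w = y" by blast
      then show ?thesis using SE by auto
    qed
  qed (use e(2)[of z] monoE in auto)
  have "(T has_real_derivative d x / e (T x)) (at x)" for x
  proof -
    have "((\<lambda>x. S (?D x)) has_real_derivative inverse (e (T x)) * d x) (at x)"
      by (rule DERIV_chain2[where g="?D"]) (use dS[of "T x"] dD in \<open>auto simp: T\<close>)
    then show ?thesis by (simp add: TS[abs_def, symmetric] divide_inverse mult.commute)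
  qed
  with T show ?thesis using that by blast
qed

text \<open>Write \<open>g\<close> for the standard normal density and let \<open>T\<close> transport the normal distribution to
  \<open>e = g * exp u\<close>. Taking logarithms in \<open>g x = e (T x) * T' x\<close>, inserting the hypothesis at the pair
  \<open>(T x, x)\<close> and using \<open>ln r \<le> r - 1\<close> gives the pointwise bound \<open>1 - \<phi> x - x\<^sup>2 \<le> T' x - x * T x\<close>.
  After multiplication by \<open>g\<close> the right-hand side is the derivative of \<open>T * g\<close>, because
  \<open>g' x = - x * g x\<close>; the left-hand side integrates to \<open>- \<integral> \<phi>\<close>. So the claim holds once the boundary
  terms of \<open>T * g\<close> vanish at infinity. If instead \<open>\<integral> \<phi>\<close> were negative, \<open>T\<close> would have to be as large as a
  multiple of \<open>1 / g\<close> arbitrarily far out, and the transported measure would have too heavy tails for its finite second moment.\<close>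

lemma std_normal_transport_normalized:
  fixes u \<phi> :: "real \<Rightarrow> real"
  assumes lipu: "\<And>x y. \<bar>u x - u y\<bar> \<le> K * \<bar>x - y\<bar>"
    and lipphi: "\<And>x y. \<bar>\<phi> x - \<phi> y\<bar> \<le> K * \<bar>x - y\<bar>"
    and le: "\<And>x y. u x \<le> \<phi> y + (x - y)\<^sup>2 / 2"
    and one: "(\<integral>x. exp (u x) \<partial>std_normal_distribution) = 1"
  shows "0 \<le> (\<integral>x. \<phi> x \<partial>std_normal_distribution)"
proof (rule ccontr)
  assume neg: "\<not> 0 \<le> (\<integral>x. \<phi> x \<partial>std_normal_distribution)"
  define c where "c = - (\<integral>x. \<phi> x \<partial>std_normal_distribution)"
  have c: "c > 0" using neg by (simp add: c_def)
  note [continuous_intros] = lipschitz_abs_imp_continuous[OF lipu] lipschitz_abs_imp_continuous[OF lipphi]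
  have [measurable]: "u \<in> borel_measurable borel" "\<phi> \<in> borel_measurable borel"
    by (auto intro!: borel_measurable_continuous_onI continuous_intros)
  let ?g = std_normal_density
  define e where "e x = ?g x * exp (u x)" for x
  have contg: "continuous_on S ?g" for S
    unfolding std_normal_density_def by (intro continuous_intros) auto
  have conte: "continuous_on UNIV e"
    unfolding e_def by (intro continuous_intros contg)
  have gpos: "0 < ?g x" for x by (simp add: normal_density_pos)
  have epos: "0 < e x" for x using gpos by (simp add: e_def)
  have [measurable]: "e \<in> borel_measurable borel" unfolding e_def by measurable
  interpret N: prob_space std_normal_distribution by (rule prob_space_normal_density) simp
  interpret N: real_distribution std_normal_distribution by (rule real_dist_normal_dist)
  define \<nu> where "\<nu> = density lborel e"
  have ie: "integrable lborel e" "integral\<^sup>L lborel e = 1"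
    using lipschitz_integrable_std_normal(2)[OF lipu] one
    by (auto simp: e_def[abs_def] integrable_density integral_density)
  have "emeasure \<nu> (space \<nu>) = (\<integral>\<^sup>+ x. ennreal (e x) \<partial>lborel)"
    by (simp add: \<nu>_def emeasure_density)
  also have "\<dots> = 1"
    using ie epos by (subst nn_integral_eq_integral) (auto intro: less_imp_le)
  finally interpret \<nu>: prob_space \<nu> by (rule prob_spaceI)
  interpret \<nu>: real_distribution \<nu> by standard (auto simp: \<nu>_def)
  obtain T where T: "\<And>x. cdf \<nu> (T x) = cdf std_normal_distribution x"
    and dT: "\<And>x. (T has_real_derivative ?g x / e (T x)) (at x)"
    by (rule exists_monotone_transport[of ?g e])
       (use contg conte gpos epos N.prob_space_axioms \<nu>.prob_space_axioms in \<open>auto simp: \<nu>_def\<close>)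
  define q where "q x = ?g x * (1 - \<phi> x - x\<^sup>2)" for x
  have contq: "continuous_on S q" for S
    unfolding q_def by (intro continuous_intros contg continuous_on_subset[OF lipschitz_abs_imp_continuous[OF lipphi]]) auto
  have [measurable]: "q \<in> borel_measurable borel" unfolding q_def by measurable
  have iq: "integrable lborel q" "integral\<^sup>L lborel q = c"
  proof -
    have i: "integrable std_normal_distribution (\<lambda>x. 1 - \<phi> x - x\<^sup>2)"
      using lipschitz_integrable_std_normal(1)[OF lipphi]
      by (intro Bochner_Integration.integrable_diff integrable_std_normal_distribution_moment) auto
    have "(\<integral>x. 1 - \<phi> x - x\<^sup>2 \<partial>std_normal_distribution) = 1 + c - 1"
      using lipschitz_integrable_std_normal(1)[OF lipphi] std_normal_distribution_even_moments[of 1] N.prob_space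
      by (simp add: c_def integrable_std_normal_distribution_moment fact_numeral)
    with i show "integrable lborel q" "integral\<^sup>L lborel q = c"
      by (auto simp: q_def[abs_def] integrable_density integral_density)
  qed
  \<comment> \<open>the pointwise inequality from the change of variables formula\<close>
  have key: "q x \<le> (?g x / e (T x) - x * T x) * ?g x" for x
  proof -
    let ?r = "?g x / e (T x)"
    have r: "?r > 0" using gpos epos by simp
    have lng: "ln (?g z) = ln (1 / sqrt (2 * pi)) - z\<^sup>2 / 2" for z
      unfolding std_normal_density_def by (subst ln_mult_pos) auto
    have "ln ?r = ln (?g x) - ln (e (T x))"
      using gpos[of x] epos[of "T x"] by (intro ln_divide_pos)
    also have "ln (e (T x)) = ln (?g (T x)) + u (T x)"
      unfolding e_def by (subst ln_mult_pos) (auto intro: gpos)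
    also have "ln (?g x) - (ln (?g (T x)) + u (T x)) = - x\<^sup>2 / 2 + (T x)\<^sup>2 / 2 - u (T x)"
      unfolding lng by simp
    also have "\<dots> \<ge> - x\<^sup>2 / 2 + (T x)\<^sup>2 / 2 - (\<phi> x + (T x - x)\<^sup>2 / 2)"
      using le[of "T x" x] by simp
    also have "- x\<^sup>2 / 2 + (T x)\<^sup>2 / 2 - (\<phi> x + (T x - x)\<^sup>2 / 2) = x * T x - x\<^sup>2 - \<phi> x"
      by (simp add: power2_eq_square field_simps)
    finally have "1 - \<phi> x - x\<^sup>2 \<le> ?r - x * T x"
      using ln_le_minus_one[OF r] by linarith
    then show ?thesis
      using gpos[of x] by (simp add: q_def mult.commute[of "?g x"])
  qed
  define G where "G x = T x * ?g x" for x
  have dG: "(G has_real_derivative (?g x / e (T x) - x * T x) * ?g x) (at x)" for x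
  proof -
    have dg: "(?g has_real_derivative - x * ?g x) (at x)"
      unfolding std_normal_density_def
      by (rule derivative_eq_intros refl | simp)+
    show ?thesis
      unfolding G_def using DERIV_mult[OF dT[of x] dg] by (simp add: algebra_simps)
  qed
  have Gq: "integral {a..b} q \<le> G b - G a" if "a \<le> b" for a b
  proof (rule has_integral_le)
    show "(q has_integral integral {a..b} q) {a..b}"
      by (intro integrable_integral integrable_continuous_real contq)
    show "((\<lambda>x. (?g x / e (T x) - x * T x) * ?g x) has_integral (G b - G a)) {a..b}"
      using that dG by (intro fundamental_theorem_of_calculus)
        (auto simp: has_real_derivative_iff_has_vector_derivative[symmetric] intro: has_field_derivative_at_within)
  qed (use key in auto)
  have lim: "(\<lambda>n. integral {- real n..real n} q) \<longlonglongrightarrow> c"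
  proof -
    have "(\<lambda>n. \<integral>x. indicator {- real n..real n} x *\<^sub>R q x \<partial>lborel) \<longlonglongrightarrow> integral\<^sup>L lborel q"
    proof (rule integral_dominated_convergence[where w="\<lambda>x. norm (q x)"])
      show "AE x in lborel. (\<lambda>n. indicator {- real n..real n} x *\<^sub>R q x) \<longlonglongrightarrow> q x"
      proof (rule AE_I2)
        fix x
        obtain m where "\<bar>x\<bar> \<le> real m" using real_arch_simple by blast
        then have "eventually (\<lambda>n. indicator {- real n..real n} x *\<^sub>R q x = q x) sequentially"
          by (intro eventually_sequentiallyI[of m]) (auto simp: indicator_def)
        then show "(\<lambda>n. indicator {- real n..real n} x *\<^sub>R q x) \<longlonglongrightarrow> q x"
          by (rule tendsto_eventually)
      qed
    qed (use iq in \<open>auto simp: indicator_def\<close>)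
    moreover have "(\<integral>x. indicator {- real n..real n} x *\<^sub>R q x \<partial>lborel) = integral {- real n..real n} q" for n
      using set_borel_integral_eq_integral(2)[OF borel_integrable_atLeastAtMost'[OF contq, of "- real n" "real n"]]
      by (simp add: set_lebesgue_integral_def)
    ultimately show ?thesis by (simp add: iq)
  qed
  define M where "M = (\<integral>x. x\<^sup>2 \<partial>\<nu>)"
  have iM: "integrable \<nu> (\<lambda>x. x\<^sup>2)"
    using lipschitz_integrable_std_normal(3)[OF lipu] epos
    by (simp add: \<nu>_def integrable_density less_imp_le e_def[abs_def] mult_ac)
  have markov: "measure \<nu> {x. y \<le> \<bar>x\<bar>} \<le> M / y\<^sup>2" if "y > 0" for y
  proof -
    have "{x. y \<le> \<bar>x\<bar>} = {x \<in> space \<nu>. y\<^sup>2 \<le> x\<^sup>2}"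
      using that by (auto simp: abs_le_square_iff[symmetric])
    then show ?thesis
      unfolding M_def using integral_Markov_inequality_measure[OF iM, of "{}" "y\<^sup>2"] that by simp
  qed
  \<comment> \<open>the mass of a unit interval bounds the normal tails from below\<close>
  have tail: "?g (R + 1) \<le> measure std_normal_distribution {R<..}"
             "?g (R + 1) \<le> measure std_normal_distribution {..-R}" if "R \<ge> 0" for R
  proof -
    have *: "?g (R + 1) \<le> measure std_normal_distribution I"
      if I: "emeasure lborel I = 1" "I \<in> sets borel" "\<And>x. x \<in> I \<Longrightarrow> \<bar>x\<bar> \<le> R + 1" for I
    proof -
      have "ennreal (?g (R + 1)) = (\<integral>\<^sup>+x. ennreal (?g (R + 1)) * indicator I x \<partial>lborel)"
        using I by (simp add: nn_integral_cmult_indicator)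
      also have "\<dots> \<le> (\<integral>\<^sup>+x. ennreal (?g x) * indicator I x \<partial>lborel)"
      proof (intro nn_integral_mono)
        fix x
        have "x\<^sup>2 \<le> (R + 1)\<^sup>2" if "x \<in> I" using I(3)[OF that] abs_le_square_iff[of x "R + 1"] \<open>R \<ge> 0\<close> by simp
        then show "ennreal (?g (R + 1)) * indicator I x \<le> ennreal (?g x) * indicator I x"
          by (auto simp: indicator_def std_normal_density_def divide_right_mono intro!: ennreal_leI)
      qed
      also have "\<dots> = emeasure std_normal_distribution I"
        using I(2) by (simp add: emeasure_density)
      finally show ?thesis
        by (simp add: N.emeasure_eq_measure)
    qed
    have "?g (R + 1) \<le> measure std_normal_distribution {R<..R + 1}"
      using that by (intro *) auto
    also have "\<dots> \<le> measure std_normal_distribution {R<..}"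
      by (intro N.finite_measure_mono) auto
    finally show "?g (R + 1) \<le> measure std_normal_distribution {R<..}" .
    have "?g (R + 1) \<le> measure std_normal_distribution {- (R + 1)..-R}"
      using that by (intro *) auto
    also have "\<dots> \<le> measure std_normal_distribution {..-R}"
      by (intro N.finite_measure_mono) auto
    finally show "?g (R + 1) \<le> measure std_normal_distribution {..-R}" .
  qed
  have upper: "measure \<nu> {T R<..} = measure std_normal_distribution {R<..}" for R
    using T[of R] \<nu>.prob_compl[of "{..T R}"] N.prob_compl[of "{..R}"]
    by (simp add: cdf_def Compl_eq_Diff_UNIV[symmetric] Compl_atMost)
  have lower: "measure \<nu> {..T R} = measure std_normal_distribution {..R}" for R
    using T[of R] by (simp add: cdf_def)
  \<comment> \<open>Either \<open>T R\<close> or \<open>- T (- R)\<close> exceeds \<open>y = c / (4 * g R)\<close>, so the tail of the normal distribution at \<open>R\<close> is at most the mass of the transported measure beyond \<open>y\<close>.\<close>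
  have ev: "eventually (\<lambda>n. ?g (real n + 1) \<le> 16 * M / c\<^sup>2 * (?g (real n))\<^sup>2) sequentially"
  proof -
    have "eventually (\<lambda>n. c / 2 < integral {- real n..real n} q) sequentially"
      using order_tendstoD(1)[OF lim, of "c / 2"] c by simp
    then show ?thesis
    proof eventually_elim
      case (elim n)
      define R where "R = real n"
      have "c / 2 < G R - G (- R)" using elim Gq[of "- R" R] by (simp add: R_def)
      also have "\<dots> = (T R - T (- R)) * ?g R"
        by (simp add: G_def std_normal_density_def add_divide_distrib diff_divide_distrib left_diff_distrib)
      finally have "c / 2 < (T R - T (- R)) * ?g R" .
      then have TT: "c / (2 * ?g R) < T R - T (- R)"
        using gpos[of R] by (simp add: field_simps)
      define y where "y = c / (4 * ?g R)"
      have y: "y > 0" using c gpos by (simp add: y_def)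
      have "?g (R + 1) \<le> measure \<nu> {x. y \<le> \<bar>x\<bar>}"
      proof (cases "y \<le> T R")
        case True
        have "?g (R + 1) \<le> measure \<nu> {T R<..}" using tail(1)[of R] upper by (simp add: R_def)
        also have "\<dots> \<le> measure \<nu> {x. y \<le> \<bar>x\<bar>}"
          using True by (intro \<nu>.finite_measure_mono) auto
        finally show ?thesis .
      next
        case False
        have "c / (2 * ?g R) = 2 * y" by (simp add: y_def)
        with False TT have "T (- R) \<le> - y" by linarith
        have "?g (R + 1) \<le> measure \<nu> {..T (- R)}" using tail(2)[of R] lower by (simp add: R_def)
        also have "\<dots> \<le> measure \<nu> {x. y \<le> \<bar>x\<bar>}"
          using \<open>T (- R) \<le> - y\<close> by (intro \<nu>.finite_measure_mono) auto
        finally show ?thesis .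
      qed
      also have "\<dots> \<le> M / y\<^sup>2" by (rule markov[OF y])
      also have "\<dots> = 16 * M / c\<^sup>2 * (?g R)\<^sup>2"
        by (simp add: y_def power_mult_distrib power_divide)
      finally show ?case by (simp add: R_def)
    qed
  qed
  have "eventually (\<lambda>n. 1 \<le> 16 * M / c\<^sup>2 / sqrt (2 * pi) * exp (real n + 1/2 - (real n)\<^sup>2 / 2)) sequentially"
    using ev
  proof eventually_elim
    case (elim n)
    have "(?g (real n))\<^sup>2 = ?g (real n + 1) * (1 / sqrt (2 * pi) * exp (real n + 1/2 - (real n)\<^sup>2 / 2))"
      by (simp add: std_normal_density_def power2_eq_square exp_add[symmetric] field_simps)
    then have "?g (real n + 1) * 1 \<le> ?g (real n + 1) * (16 * M / c\<^sup>2 / sqrt (2 * pi) * exp (real n + 1/2 - (real n)\<^sup>2 / 2))"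
      using elim by (simp only: mult_1_right) (simp add: mult_ac)
    then show ?case using gpos[of "real n + 1"] by (simp only: mult_le_cancel_left_pos)
  qed
  moreover have "(\<lambda>n. 16 * M / c\<^sup>2 / sqrt (2 * pi) * exp (real n + 1/2 - (real n)\<^sup>2 / 2)) \<longlonglongrightarrow> 16 * M / c\<^sup>2 / sqrt (2 * pi) * 0"
    by (intro tendsto_mult tendsto_const) real_asymp
  ultimately have "1 \<le> 16 * M / c\<^sup>2 / sqrt (2 * pi) * 0"
    by (intro tendsto_lowerbound) auto
  then show False by simp
qed

text \<open>Subtracting the logarithm of \<open>\<integral> exp u\<close> from both functions reduces this to the normalised case. It
  is the dual form of Talagrand's transport inequality on the line.\<close>

lemma std_normal_infconv:
  fixes u \<phi> :: "real \<Rightarrow> real"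
  assumes lipu: "\<And>x y. \<bar>u x - u y\<bar> \<le> K * \<bar>x - y\<bar>"
    and lipphi: "\<And>x y. \<bar>\<phi> x - \<phi> y\<bar> \<le> K * \<bar>x - y\<bar>"
    and le: "\<And>x y. u x \<le> \<phi> y + (x - y)\<^sup>2 / 2"
  shows "0 < (\<integral>x. exp (u x) \<partial>std_normal_distribution)"
    and "(\<integral>x. exp (u x) \<partial>std_normal_distribution) \<le> exp (\<integral>x. \<phi> x \<partial>std_normal_distribution)"
proof -
  interpret N: prob_space std_normal_distribution by (rule prob_space_normal_density) simp
  define Z where "Z = (\<integral>x. exp (u x) \<partial>std_normal_distribution)"
  note iu = lipschitz_integrable_std_normal(2)[OF lipu]
  have "Z \<noteq> 0"
  proof
    assume "Z = 0"
    then have "AE x in std_normal_distribution. exp (u x) = 0"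
      using iu unfolding Z_def by (subst (asm) integral_nonneg_eq_0_iff_AE) auto
    then show False using N.AE_False by simp
  qed
  moreover have "0 \<le> Z" unfolding Z_def by (intro Bochner_Integration.integral_nonneg) simp
  ultimately have "0 < Z" by simp
  then show Z: "0 < (\<integral>x. exp (u x) \<partial>std_normal_distribution)" unfolding Z_def .
  have "0 \<le> (\<integral>x. \<phi> x - ln Z \<partial>std_normal_distribution)"
  proof (rule std_normal_transport_normalized)
    show "(\<integral>x. exp (u x - ln Z) \<partial>std_normal_distribution) = 1"
      using Z by (simp add: Z_def exp_diff)
    show "u x - ln Z \<le> \<phi> y - ln Z + (x - y)\<^sup>2 / 2" for x y using le[of x y] by simp
  qed (use lipu lipphi in auto)
  also have "\<dots> = (\<integral>x. \<phi> x \<partial>std_normal_distribution) - ln Z"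
    using lipschitz_integrable_std_normal(1)[OF lipphi] N.prob_space by simp
  finally have "ln Z \<le> (\<integral>x. \<phi> x \<partial>std_normal_distribution)" by simp
  then have "exp (ln Z) \<le> exp (\<integral>x. \<phi> x \<partial>std_normal_distribution)" by simp
  then show "(\<integral>x. exp (u x) \<partial>std_normal_distribution) \<le> exp (\<integral>x. \<phi> x \<partial>std_normal_distribution)"
    using Z by (simp add: Z_def)
qed

section \<open>Concentration for products of normal distributions\<close>

abbreviation gaussian_product :: "'i set \<Rightarrow> ('i \<Rightarrow> real) measure"
  where "gaussian_product I \<equiv> (\<Pi>\<^sub>M i\<in>I. std_normal_distribution)"

lemma product_prob_space_gaussian: "product_prob_space (\<lambda>_. std_normal_distribution)"
proof -
  interpret N: prob_space std_normal_distribution by (rule prob_space_normal_density) simp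
  show ?thesis by standard
qed

text \<open>Lipschitz continuity is meant with respect to the sum of the coordinate distances; it provides the
  integrable majorant \<open>exp \<bar>u 0\<bar> * (\<Prod>i\<in>I. exp (K * \<bar>x i\<bar>))\<close>.\<close>

lemma lipschitz_integrable_gaussian_product:
  fixes u :: "('i \<Rightarrow> real) \<Rightarrow> real"
  assumes I: "finite I" and [measurable]: "u \<in> borel_measurable (gaussian_product I)"
    and lip: "\<And>x y. \<bar>u x - u y\<bar> \<le> K * (\<Sum>i\<in>I. \<bar>x i - y i\<bar>)"
  shows "integrable (gaussian_product I) u" "integrable (gaussian_product I) (\<lambda>x. exp (u x))"
proof -
  interpret product_prob_space "\<lambda>_::'i. std_normal_distribution" by (rule product_prob_space_gaussian)
  let ?b = "\<lambda>x. exp \<bar>u (\<lambda>_. 0)\<bar> * (\<Prod>i\<in>I. exp (K * \<bar>x i\<bar>))"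
  have b: "integrable (gaussian_product I) ?b"
    by (intro integrable_mult_right product_integrable_prod I integrable_std_normal_exp_abs)
  have le: "exp \<bar>u x\<bar> \<le> ?b x" for x
  proof -
    have "\<bar>u x\<bar> \<le> \<bar>u (\<lambda>_. 0)\<bar> + (\<Sum>i\<in>I. K * \<bar>x i\<bar>)"
      using lip[of x "\<lambda>_. 0"] by (auto simp: sum_distrib_left)
    then have "exp \<bar>u x\<bar> \<le> exp (\<bar>u (\<lambda>_. 0)\<bar> + (\<Sum>i\<in>I. K * \<bar>x i\<bar>))" by simp
    then show ?thesis by (simp add: exp_add exp_sum[OF I])
  qed
  have bpos: "0 \<le> ?b x" for x by (intro mult_nonneg_nonneg prod_nonneg) auto
  show "integrable (gaussian_product I) u"
  proof (rule Bochner_Integration.integrable_bound[OF b])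
    have "norm (u x) \<le> norm (?b x)" for x
    proof -
      have "\<bar>u x\<bar> \<le> ?b x" using le[of x] exp_ge_add_one_self[of "\<bar>u x\<bar>"] by linarith
      then show ?thesis using bpos[of x] by (simp only: real_norm_def abs_of_nonneg)
    qed
    then show "AE x in gaussian_product I. norm (u x) \<le> norm (?b x)" by simp
  qed simp
  show "integrable (gaussian_product I) (\<lambda>x. exp (u x))"
  proof (rule Bochner_Integration.integrable_bound[OF b])
    have "norm (exp (u x)) \<le> norm (?b x)" for x
    proof -
      have "exp (u x) \<le> exp \<bar>u x\<bar>" by simp
      then have "exp (u x) \<le> ?b x" using le[of x] by (rule order_trans)
      then show ?thesis using bpos[of x] by (simp only: real_norm_def abs_of_nonneg abs_exp_cancel)
    qed
    then show "AE x in gaussian_product I. norm (exp (u x)) \<le> norm (?b x)" by simp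
  qed simp
qed

text \<open>Integrating out the coordinate \<open>j\<close> turns the pair \<open>(u, \<phi>)\<close> into the pair
  \<open>(ln (\<integral> exp u), \<integral> \<phi>)\<close> of functions of the remaining coordinates. The one-dimensional inequality,
  applied to the sections of \<open>u\<close> at \<open>x\<close> and of \<open>\<phi>\<close> at \<open>x'\<close> with the squared distance of \<open>x\<close> and \<open>x'\<close>
  added to the latter, is the hypothesis for the new pair.\<close>

theorem gaussian_product_infconv:
  fixes u \<phi> :: "('i \<Rightarrow> real) \<Rightarrow> real"
  assumes "finite I"
    and "u \<in> borel_measurable (gaussian_product I)" "\<phi> \<in> borel_measurable (gaussian_product I)"
    and "\<And>x y. \<bar>u x - u y\<bar> \<le> K * (\<Sum>i\<in>I. \<bar>x i - y i\<bar>)"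
    and "\<And>x y. \<bar>\<phi> x - \<phi> y\<bar> \<le> K * (\<Sum>i\<in>I. \<bar>x i - y i\<bar>)"
    and "\<And>x y. u x \<le> \<phi> y + (\<Sum>i\<in>I. (x i - y i)\<^sup>2) / 2"
  shows "(\<integral>x. exp (u x) \<partial>gaussian_product I) \<le> exp (\<integral>x. \<phi> x \<partial>gaussian_product I)"
  using assms
proof (induction I arbitrary: u \<phi> rule: finite_induct)
  case empty
  show ?case
    using empty(5)[of "\<lambda>_. undefined" "\<lambda>_. undefined"]
    by (simp add: PiM_empty lebesgue_integral_count_space_finite)
next
  case (insert j I)
  interpret product_prob_space "\<lambda>_::'i. std_normal_distribution" by (rule product_prob_space_gaussian)
  note mu[measurable] = insert.prems(1) and mphi[measurable] = insert.prems(2)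
  note lipu = insert.prems(3) and lipphi = insert.prems(4) and le = insert.prems(5)
  note fin = insert.hyps(1) and jI = insert.hyps(2)
  have upd: "(\<Sum>i\<in>I. h ((x(j := y)) i) ((x'(j := y')) i)) = (\<Sum>i\<in>I. h (x i) (x' i))"
    for x x' :: "'i \<Rightarrow> real" and y y' and h :: "real \<Rightarrow> real \<Rightarrow> real"
    using jI by (intro sum.cong) auto
  have lip_fst: "\<bar>w (x(j := y)) - w (x'(j := y))\<bar> \<le> K * (\<Sum>i\<in>I. \<bar>x i - x' i\<bar>)"
    if "\<And>x y. \<bar>w x - w y\<bar> \<le> K * (\<Sum>i\<in>insert j I. \<bar>x i - y i\<bar>)" for w x x' y
    using that[of "x(j := y)" "x'(j := y)"] upd[of "\<lambda>a b. \<bar>a - b\<bar>" x y x' y] fin jI by simp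
  have lip_snd: "\<bar>w (x(j := y)) - w (x(j := y'))\<bar> \<le> K * \<bar>y - y'\<bar>"
    if "\<And>x y. \<bar>w x - w y\<bar> \<le> K * (\<Sum>i\<in>insert j I. \<bar>x i - y i\<bar>)" for w x y y'
    using that[of "x(j := y)" "x(j := y')"] upd[of "\<lambda>a b. \<bar>a - b\<bar>" x y x y'] fin jI by simp
  have meas: "(\<lambda>(x, y). w (x(j := y))) \<in> borel_measurable (gaussian_product I \<Otimes>\<^sub>M std_normal_distribution)"
    if [measurable]: "w \<in> borel_measurable (gaussian_product (insert j I))" for w :: "('i \<Rightarrow> real) \<Rightarrow> real"
    using measurable_compose[OF measurable_add_dim that] by (simp add: case_prod_beta')
  define U where "U x = (\<integral>y. exp (u (x(j := y))) \<partial>std_normal_distribution)" for x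
  define F where "F x = (\<integral>y. \<phi> (x(j := y)) \<partial>std_normal_distribution)" for x
  have iu: "integrable std_normal_distribution (\<lambda>y. exp (u (x(j := y))))" for x
    by (rule lipschitz_integrable_std_normal(2)) (rule lip_snd[OF lipu])
  have iphi: "integrable std_normal_distribution (\<lambda>y. \<phi> (x(j := y)))" for x
    by (rule lipschitz_integrable_std_normal(1)) (rule lip_snd[OF lipphi])
  have Ule: "0 < U x \<and> U x \<le> exp (F x' + (\<Sum>i\<in>I. (x i - x' i)\<^sup>2) / 2)" for x x'
  proof -
    let ?S = "(\<Sum>i\<in>I. (x i - x' i)\<^sup>2) / 2"
    have a1: "u (x(j := y)) \<le> (\<phi> (x'(j := y')) + ?S) + (y - y')\<^sup>2 / 2" for y y'
    proof -
      have "(\<Sum>i\<in>insert j I. ((x(j := y)) i - (x'(j := y')) i)\<^sup>2) = (y - y')\<^sup>2 + (\<Sum>i\<in>I. (x i - x' i)\<^sup>2)"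
        using upd[of "\<lambda>a b. (a - b)\<^sup>2" x y x' y'] fin jI by simp
      then show ?thesis
        using le[of "x(j := y)" "x'(j := y')"] by linarith
    qed
    have a2: "\<bar>(\<phi> (x'(j := y)) + ?S) - (\<phi> (x'(j := y')) + ?S)\<bar> \<le> K * \<bar>y - y'\<bar>" for y y'
      unfolding add_diff_cancel_right by (rule lip_snd[OF lipphi])
    have "0 < U x" "U x \<le> exp (\<integral>y. \<phi> (x'(j := y)) + ?S \<partial>std_normal_distribution)"
      unfolding U_def using std_normal_infconv[OF lip_snd[OF lipu] a2 a1] by auto
    then show ?thesis
      using iphi M.prob_space by (simp add: F_def)
  qed
  have Upos: "0 < U x" for x using Ule by blast
  have lipU: "U x \<le> exp (K * (\<Sum>i\<in>I. \<bar>x i - x' i\<bar>)) * U x'" for x x'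
  proof -
    let ?d = "K * (\<Sum>i\<in>I. \<bar>x i - x' i\<bar>)"
    have "U x \<le> (\<integral>y. exp ?d * exp (u (x'(j := y))) \<partial>std_normal_distribution)"
      unfolding U_def
    proof (intro integral_mono iu integrable_mult_right)
      fix y
      show "exp (u (x(j := y))) \<le> exp ?d * exp (u (x'(j := y)))"
        unfolding exp_add[symmetric] exp_le_cancel_iff using lip_fst[OF lipu, of x y x'] by linarith
    qed
    then show ?thesis by (simp add: U_def)
  qed
  have "(\<integral>x. exp (u x) \<partial>gaussian_product (insert j I)) = (\<integral>x. U x \<partial>gaussian_product I)"
    unfolding U_def
    by (intro product_integral_insert fin jI lipschitz_integrable_gaussian_product(2)[OF _ mu lipu]) (use fin in auto)
  also have "\<dots> = (\<integral>x. exp (ln (U x)) \<partial>gaussian_product I)"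
    using Upos by simp
  also have "\<dots> \<le> exp (\<integral>x. F x \<partial>gaussian_product I)"
  proof (rule insert.IH)
    show "(\<lambda>x. ln (U x)) \<in> borel_measurable (gaussian_product I)"
    proof -
      have "U \<in> borel_measurable (gaussian_product I)"
        unfolding U_def using meas[OF mu]
        by (intro M.borel_measurable_lebesgue_integral) (simp add: case_prod_beta')
      then show ?thesis by measurable
    qed
    show "F \<in> borel_measurable (gaussian_product I)"
      unfolding F_def using meas[OF mphi]
      by (intro M.borel_measurable_lebesgue_integral) (simp add: case_prod_beta')
    have *: "ln (U x) \<le> K * (\<Sum>i\<in>I. \<bar>x i - y i\<bar>) + ln (U y)" for x y
    proof -
      have "ln (U x) \<le> ln (exp (K * (\<Sum>i\<in>I. \<bar>x i - y i\<bar>)) * U y)"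
        using lipU[of x y] Upos by (simp add: ln_le_cancel_iff)
      then show ?thesis using Upos[of y] by (simp add: ln_mult_pos)
    qed
    show "\<bar>ln (U x) - ln (U y)\<bar> \<le> K * (\<Sum>i\<in>I. \<bar>x i - y i\<bar>)" for x y
    proof -
      have "(\<Sum>i\<in>I. \<bar>y i - x i\<bar>) = (\<Sum>i\<in>I. \<bar>x i - y i\<bar>)"
        by (simp add: abs_minus_commute)
      then show ?thesis using *[of x y] *[of y x] by (simp add: abs_le_iff)
    qed
    show "\<bar>F x - F y\<bar> \<le> K * (\<Sum>i\<in>I. \<bar>x i - y i\<bar>)" for x y
    proof -
      have "\<bar>F x - F y\<bar> = \<bar>\<integral>z. \<phi> (x(j := z)) - \<phi> (y(j := z)) \<partial>std_normal_distribution\<bar>"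
        using iphi by (simp add: F_def)
      also have "\<dots> \<le> (\<integral>z. \<bar>\<phi> (x(j := z)) - \<phi> (y(j := z))\<bar> \<partial>std_normal_distribution)"
        by (rule integral_abs_bound)
      also have "\<dots> \<le> (\<integral>z. K * (\<Sum>i\<in>I. \<bar>x i - y i\<bar>) \<partial>std_normal_distribution)"
      proof (rule integral_mono)
        show "\<bar>\<phi> (x(j := z)) - \<phi> (y(j := z))\<bar> \<le> K * (\<Sum>i\<in>I. \<bar>x i - y i\<bar>)" for z
          by (rule lip_fst[OF lipphi])
      qed (use iphi in auto)
      finally show ?thesis using M.prob_space by simp
    qed
    show "ln (U x) \<le> F y + (\<Sum>i\<in>I. (x i - y i)\<^sup>2) / 2" for x y
      using Ule[of x y] by (metis exp_le_cancel_iff exp_ln)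
  qed
  also have "(\<integral>x. F x \<partial>gaussian_product I) = (\<integral>x. \<phi> x \<partial>gaussian_product (insert j I))"
    unfolding F_def
    by (intro product_integral_insert[symmetric] fin jI lipschitz_integrable_gaussian_product(1)[OF _ mphi lipphi]) (use fin in auto)
  finally show ?case .
qed

text \<open>With \<open>r\<close> the Euclidean distance of \<open>x\<close> and \<open>y\<close>, \<open>t * r \<le> t\<^sup>2 / 2 + r\<^sup>2 / 2\<close> makes
  \<open>u = c * f - t\<^sup>2 / 2\<close> and \<open>\<phi> = c * f\<close> admissible in the transport inequality when \<open>c * L = t\<close>.
  This bounds the exponential moment of \<open>f\<close>, and Markov's inequality at the optimal parameter
  \<open>c = t / L\<close> gives the tail.\<close>

theorem gaussian_concentration:
  fixes f :: "('i \<Rightarrow> real) \<Rightarrow> real"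
  assumes I: "finite I" and mf[measurable]: "f \<in> borel_measurable (gaussian_product I)"
    and lip: "\<And>x y. \<bar>f x - f y\<bar> \<le> L * L2_set (\<lambda>i. x i - y i) I" and L: "L > 0"
    and a: "(\<integral>x. f x \<partial>gaussian_product I) \<le> a" and t: "t > 0"
  shows "measure (gaussian_product I) {x \<in> space (gaussian_product I). a + t * L \<le> f x} \<le> exp (- t\<^sup>2 / 2)"
proof -
  interpret product_prob_space "\<lambda>_::'i. std_normal_distribution" I by (rule product_prob_space_gaussian)
  define c where "c = t / L"
  have c: "c > 0" "c * L = t" using t L by (auto simp: c_def)
  have lip1: "\<bar>c * f x - c * f y\<bar> \<le> t * (\<Sum>i\<in>I. \<bar>x i - y i\<bar>)" for x y
  proof -
    have "\<bar>c * f x - c * f y\<bar> = c * \<bar>f x - f y\<bar>"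
      using c by (simp add: abs_mult right_diff_distrib[symmetric])
    also have "\<dots> \<le> c * (L * L2_set (\<lambda>i. x i - y i) I)"
      using c lip by (intro mult_left_mono) auto
    also have "\<dots> \<le> c * (L * (\<Sum>i\<in>I. \<bar>x i - y i\<bar>))"
      using c L by (intro mult_left_mono L2_set_le_sum_abs) auto
    finally show ?thesis using c by (simp add: mult.assoc[symmetric])
  qed
  have mgf: "(\<integral>x. exp (c * f x - t\<^sup>2 / 2) \<partial>gaussian_product I) \<le> exp (\<integral>x. c * f x \<partial>gaussian_product I)"
  proof (rule gaussian_product_infconv[OF I])
    show "c * f x - t\<^sup>2 / 2 \<le> c * f y + (\<Sum>i\<in>I. (x i - y i)\<^sup>2) / 2" for x y
    proof -
      let ?r = "L2_set (\<lambda>i. x i - y i) I"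
      have "c * (f x - f y) \<le> c * (L * ?r)"
        using lip[of x y] c by (intro mult_left_mono) auto
      also have "\<dots> = t * ?r" using c by (simp add: mult.assoc[symmetric])
      also have "\<dots> \<le> t\<^sup>2 / 2 + ?r\<^sup>2 / 2"
        using sum_squares_bound[of t ?r] by simp
      also have "?r\<^sup>2 = (\<Sum>i\<in>I. (x i - y i)\<^sup>2)"
        by (simp add: L2_set_def sum_nonneg)
      finally show ?thesis by (simp add: algebra_simps)
    qed
  qed (use lip1 in auto)
  have iexp: "integrable (gaussian_product I) (\<lambda>x. exp (c * f x - t\<^sup>2 / 2))"
    by (rule lipschitz_integrable_gaussian_product(2)[OF I, where K=t]) (use lip1 in auto)
  have "{x \<in> space (gaussian_product I). a + t * L \<le> f x}
     = {x \<in> space (gaussian_product I). exp (c * (a + t * L) - t\<^sup>2 / 2) \<le> exp (c * f x - t\<^sup>2 / 2)}"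
    using c by auto
  then have "measure (gaussian_product I) {x \<in> space (gaussian_product I). a + t * L \<le> f x}
     \<le> (\<integral>x. exp (c * f x - t\<^sup>2 / 2) \<partial>gaussian_product I) / exp (c * (a + t * L) - t\<^sup>2 / 2)"
    using integral_Markov_inequality_measure[OF iexp, of "{}" "exp (c * (a + t * L) - t\<^sup>2 / 2)"] by simp
  also have "\<dots> \<le> exp (c * a) / exp (c * (a + t * L) - t\<^sup>2 / 2)"
    using mgf a c by (intro divide_right_mono) (auto intro: order_trans)
  also have "\<dots> = exp (- t\<^sup>2 / 2)"
  proof -
    have "c * (a + t * L) = c * a + t\<^sup>2" using c by (simp add: algebra_simps power2_eq_square)
    then show ?thesis by (simp add: exp_diff[symmetric])
  qed
  finally show ?thesis .
qed

section \<open>Weighted p-norms\<close>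

definition weighted_norm :: "real \<Rightarrow> 'i set \<Rightarrow> ('i \<Rightarrow> real) \<Rightarrow> ('i \<Rightarrow> real) \<Rightarrow> real"
  where "weighted_norm p I w x = (\<Sum>i\<in>I. (w i * \<bar>x i\<bar>) powr p) powr (1 / p)"

lemma weighted_norm_nonneg: "0 \<le> weighted_norm p I w x"
  by (simp add: weighted_norm_def)

lemma weighted_norm_powr:
  assumes "p > 0"
  shows "weighted_norm p I w x powr p = (\<Sum>i\<in>I. (w i * \<bar>x i\<bar>) powr p)"
  using assms by (simp add: weighted_norm_def powr_powr sum_nonneg)

lemma weighted_norm_le_iff:
  assumes "p > 0" "0 \<le> c"
  shows "weighted_norm p I w x \<le> c \<longleftrightarrow> (\<Sum>i\<in>I. (w i * \<bar>x i\<bar>) powr p) \<le> c powr p"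
proof -
  have "weighted_norm p I w x \<le> c \<longleftrightarrow> weighted_norm p I w x powr p \<le> c powr p"
    using assms weighted_norm_nonneg[of p I w x]
    by (meson linorder_not_le powr_less_mono2 powr_mono2 less_imp_le)
  then show ?thesis using assms by (simp add: weighted_norm_powr)
qed

lemma weighted_norm_scale:
  assumes "p > 0"
  shows "weighted_norm p I w (\<lambda>i. c * x i) = \<bar>c\<bar> * weighted_norm p I w x"
proof -
  have "(w i * \<bar>c * x i\<bar>) powr p = \<bar>c\<bar> powr p * (w i * \<bar>x i\<bar>) powr p" for i
  proof -
    have "w i * \<bar>c * x i\<bar> = \<bar>c\<bar> * (w i * \<bar>x i\<bar>)" by (simp add: abs_mult)
    then show ?thesis by (simp only: powr_mult)
  qed
  then have "(\<Sum>i\<in>I. (w i * \<bar>c * x i\<bar>) powr p) = \<bar>c\<bar> powr p * (\<Sum>i\<in>I. (w i * \<bar>x i\<bar>) powr p)"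
    by (simp only: sum_distrib_left)
  then show ?thesis
    using assms unfolding weighted_norm_def by (simp only: powr_mult powr_powr) simp
qed

lemma powr_convex_nonneg:
  fixes a b s p :: real
  assumes p: "1 \<le> p" and "0 \<le> a" "0 \<le> b" "0 \<le> s" "s \<le> 1"
  shows "(s * a + (1 - s) * b) powr p \<le> s * a powr p + (1 - s) * b powr p"
proof -
  have 0: "(r * b) powr p \<le> r * b powr p" if "0 \<le> r" "r \<le> 1" "0 \<le> b" for r b :: real
  proof -
    have "r powr p \<le> r"
    proof (cases "r = 0")
      case False
      then have "r powr p \<le> r powr 1" using that p by (intro powr_mono') auto
      then show ?thesis using that by simp
    qed (use p in simp)
    then show ?thesis using that by (simp add: powr_mult mult_right_mono)
  qed
  consider "a = 0" | "b = 0" | "0 < a" "0 < b" using assms by linarith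
  then show ?thesis
  proof cases
    case 3
    then show ?thesis
      using convex_onD[OF powr_convex[OF p], of "1 - s" a b] assms by simp
  qed (use 0[of "1 - s" b] 0[of s a] assms in auto)
qed

text \<open>If \<open>a\<close> and \<open>b\<close> exceed the norms of \<open>x\<close> and \<open>y\<close>, then \<open>(x + y) / (a + b)\<close> is a convex
  combination of \<open>x / a\<close> and \<open>y / b\<close>, and convexity of the \<open>p\<close>-th power keeps it in the unit ball. The
  slack \<open>e\<close> avoids division by zero when a norm vanishes.\<close>

lemma weighted_norm_triangle:
  assumes p: "1 \<le> p" and w: "\<And>i. i \<in> I \<Longrightarrow> 0 \<le> w i"
  shows "weighted_norm p I w (\<lambda>i. x i + y i) \<le> weighted_norm p I w x + weighted_norm p I w y"
proof -
  have main: "weighted_norm p I w (\<lambda>i. x i + y i) \<le> a + b"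
    if a: "weighted_norm p I w x \<le> a" "0 < a" and b: "weighted_norm p I w y \<le> b" "0 < b" for a b
  proof -
    define s where "s = a / (a + b)"
    have s: "0 \<le> s" "s \<le> 1" "1 - s = b / (a + b)" using a b by (auto simp: s_def field_simps)
    have "(w i * \<bar>x i + y i\<bar>) powr p
        \<le> (a + b) powr p * (s * ((w i * \<bar>x i\<bar>) powr p / a powr p) + (1 - s) * ((w i * \<bar>y i\<bar>) powr p / b powr p))"
      if i: "i \<in> I" for i
    proof -
      have "w i * \<bar>x i + y i\<bar> \<le> w i * (\<bar>x i\<bar> + \<bar>y i\<bar>)"
        using w[OF i] by (intro mult_left_mono abs_triangle_ineq)
      also have "\<dots> = (a + b) * (s * (w i * \<bar>x i\<bar> / a) + (1 - s) * (w i * \<bar>y i\<bar> / b))"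
      proof -
        have "(a + b) * s = a" "(a + b) * (1 - s) = b" using a b s(3) by (auto simp: s_def)
        then have "(a + b) * (s * (w i * \<bar>x i\<bar> / a)) = w i * \<bar>x i\<bar>"
            "(a + b) * ((1 - s) * (w i * \<bar>y i\<bar> / b)) = w i * \<bar>y i\<bar>"
          using a b by (auto simp: mult.assoc[symmetric])
        then show ?thesis by (simp only: distrib_left)
      qed
      finally have "(w i * \<bar>x i + y i\<bar>) powr p
          \<le> ((a + b) * (s * (w i * \<bar>x i\<bar> / a) + (1 - s) * (w i * \<bar>y i\<bar> / b))) powr p"
        using p w[OF i] by (intro powr_mono2) auto
      also have "\<dots> = (a + b) powr p * (s * (w i * \<bar>x i\<bar> / a) + (1 - s) * (w i * \<bar>y i\<bar> / b)) powr p"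
        by (rule powr_mult)
      also have "\<dots> \<le> (a + b) powr p * (s * (w i * \<bar>x i\<bar> / a) powr p + (1 - s) * (w i * \<bar>y i\<bar> / b) powr p)"
        using p s a b w[OF i] by (intro mult_left_mono powr_convex_nonneg) auto
      finally show ?thesis by (simp add: powr_divide)
    qed
    then have "(\<Sum>i\<in>I. (w i * \<bar>x i + y i\<bar>) powr p)
        \<le> (\<Sum>i\<in>I. (a + b) powr p * (s * ((w i * \<bar>x i\<bar>) powr p / a powr p) + (1 - s) * ((w i * \<bar>y i\<bar>) powr p / b powr p)))"
      by (rule sum_mono)
    also have "\<dots> = (a + b) powr p * (s * ((\<Sum>i\<in>I. (w i * \<bar>x i\<bar>) powr p) / a powr p)
        + (1 - s) * ((\<Sum>i\<in>I. (w i * \<bar>y i\<bar>) powr p) / b powr p))"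
      by (simp add: sum_distrib_left[symmetric] sum.distrib sum_divide_distrib[symmetric])
    also have "\<dots> \<le> (a + b) powr p * (s * 1 + (1 - s) * 1)"
      using a b p s by (intro mult_left_mono add_mono) (auto simp: weighted_norm_le_iff divide_le_eq)
    finally show ?thesis
      using p a b by (simp add: weighted_norm_le_iff)
  qed
  show ?thesis
  proof (rule field_le_epsilon)
    fix e :: real assume "0 < e"
    then show "weighted_norm p I w (\<lambda>i. x i + y i) \<le> weighted_norm p I w x + weighted_norm p I w y + e"
      using main[of "weighted_norm p I w x + e / 2" "weighted_norm p I w y + e / 2"]
        weighted_norm_nonneg[of p I w x] weighted_norm_nonneg[of p I w y] by simp
  qed
qed

lemma weighted_norm_lipschitz:
  assumes p: "1 \<le> p" and w: "\<And>i. i \<in> I \<Longrightarrow> 0 \<le> w i"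
    and L: "\<And>z. weighted_norm p I w z \<le> L * L2_set z I"
  shows "\<bar>weighted_norm p I w x - weighted_norm p I w y\<bar> \<le> L * L2_set (\<lambda>i. x i - y i) I"
proof -
  have *: "weighted_norm p I w x - weighted_norm p I w y \<le> L * L2_set (\<lambda>i. x i - y i) I" for x y
    using weighted_norm_triangle[where I=I and w=w and p=p and x=y and y="\<lambda>i. x i - y i", OF p w] L[of "\<lambda>i. x i - y i"] by simp
  have "L2_set (\<lambda>i. y i - x i) I = L2_set (\<lambda>i. x i - y i) I"
    by (simp add: L2_set_def power2_commute)
  with *[of x y] *[of y x] show ?thesis by (simp add: abs_le_iff)
qed

lemma abs_le_L2_set:
  assumes "finite I" "i \<in> I"
  shows "\<bar>z i\<bar> \<le> L2_set z I"
proof -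
  have "(z i)\<^sup>2 \<le> (\<Sum>i\<in>I. (z i)\<^sup>2)" using assms by (intro member_le_sum) auto
  then have "sqrt ((z i)\<^sup>2) \<le> L2_set z I" unfolding L2_set_def by (rule real_sqrt_le_mono)
  then show ?thesis by simp
qed

text \<open>Here \<open>\<bar>z i\<bar> powr p = \<bar>z i\<bar>\<^sup>2 * \<bar>z i\<bar> powr (p - 2)\<close>, and the second factor is bounded by the Euclidean norm.\<close>

lemma weighted_norm_le_L2_ge2:
  assumes I: "finite I" and p: "2 \<le> p" and w: "\<And>i. i \<in> I \<Longrightarrow> 0 \<le> w i \<and> w i \<le> L"
  shows "weighted_norm p I w z \<le> L * L2_set z I"
proof (cases "I = {}")
  case False
  then have L: "0 \<le> L" using w by force
  let ?r = "L2_set z I"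
  have "(w i * \<bar>z i\<bar>) powr p \<le> L powr p * ((z i)\<^sup>2 * ?r powr (p - 2))" if i: "i \<in> I" for i
  proof -
    have "(w i * \<bar>z i\<bar>) powr p \<le> (L * \<bar>z i\<bar>) powr p"
      using w[OF i] p by (intro powr_mono2 mult_right_mono) auto
    also have "\<dots> = L powr p * (\<bar>z i\<bar> powr 2 * \<bar>z i\<bar> powr (p - 2))"
    proof -
      have "\<bar>z i\<bar> powr p = \<bar>z i\<bar> powr 2 * \<bar>z i\<bar> powr (p - 2)"
        by (simp only: powr_add[symmetric]) simp
      then show ?thesis by (simp only: powr_mult)
    qed
    also have "\<dots> \<le> L powr p * (\<bar>z i\<bar> powr 2 * ?r powr (p - 2))"
      using p abs_le_L2_set[OF I i] by (intro mult_left_mono powr_mono2) auto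
    also have "\<bar>z i\<bar> powr 2 = (z i)\<^sup>2" by (cases "z i = 0") (auto simp: powr_numeral)
    finally show ?thesis .
  qed
  then have "(\<Sum>i\<in>I. (w i * \<bar>z i\<bar>) powr p) \<le> (\<Sum>i\<in>I. L powr p * ((z i)\<^sup>2 * ?r powr (p - 2)))"
    by (rule sum_mono)
  also have "\<dots> = L powr p * ((\<Sum>i\<in>I. (z i)\<^sup>2) * ?r powr (p - 2))"
    by (simp add: sum_distrib_left sum_distrib_right)
  also have "(\<Sum>i\<in>I. (z i)\<^sup>2) = ?r powr 2"
    by (cases "?r = 0") (auto simp: powr_numeral L2_set_def sum_nonneg)
  also have "L powr p * (?r powr 2 * ?r powr (p - 2)) = (L * ?r) powr p"
    by (simp only: powr_mult powr_add[symmetric]) simp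
  finally show ?thesis
    using p L by (simp add: weighted_norm_le_iff)
qed (simp add: weighted_norm_def L2_set_def)

text \<open>This is Hoelder's inequality with the exponents \<open>2 / (2 - p)\<close> and \<open>2 / p\<close>, obtained by summing Young's
  inequality for the normalised terms.\<close>

lemma weighted_norm_le_L2_less2:
  assumes I: "finite I" "I \<noteq> {}" and p: "1 \<le> p" "p < 2" and w: "\<And>i. i \<in> I \<Longrightarrow> 0 < w i"
  shows "weighted_norm p I w z \<le> (\<Sum>i\<in>I. w i powr (2 * p / (2 - p))) powr (1 / p - 1 / 2) * L2_set z I"
proof (cases "L2_set z I = 0")
  case True
  then have "z i = 0" if "i \<in> I" for i using abs_le_L2_set[OF I(1) that, of z] by simp
  then show ?thesis using p by (simp add: weighted_norm_def True)
next
  case False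
  let ?r = "L2_set z I" and ?q = "2 * p / (2 - p)"
  define S where "S = (\<Sum>i\<in>I. w i powr ?q)"
  have S: "S > 0" unfolding S_def using w I by (intro sum_pos) (auto simp: less_imp_neq[OF w, symmetric])
  have r: "?r > 0" using False L2_set_nonneg[of z I] by linarith
  let ?a = "(2 - p) / 2"
  have "(w i * \<bar>z i\<bar>) powr p \<le> (S powr ?a * ?r powr p) * (?a * (w i powr ?q / S) + (p / 2) * ((z i)\<^sup>2 / ?r\<^sup>2))"
    if i: "i \<in> I" for i
  proof (cases "z i = 0")
    case True
    then show ?thesis using S p by (simp add: mult_nonneg_nonneg)
  next
    case False
    have "(w i * \<bar>z i\<bar>) powr p = (S powr ?a * ?r powr p) * ((w i powr ?q / S) powr ?a * ((z i)\<^sup>2 / ?r\<^sup>2) powr (p / 2))"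
    proof -
      have "(w i powr ?q) powr ?a = w i powr p" using p by (simp add: powr_powr)
      moreover have "((z i)\<^sup>2 / ?r\<^sup>2) powr (p / 2) = (\<bar>z i\<bar> / ?r) powr p"
      proof -
        have "(z i)\<^sup>2 / ?r\<^sup>2 = (\<bar>z i\<bar> / ?r) powr 2"
          using False r by (simp add: powr_numeral power_divide)
        then show ?thesis by (simp only: powr_powr) simp
      qed
      ultimately show ?thesis using S r by (simp add: powr_divide powr_mult)
    qed
    also have "\<dots> \<le> (S powr ?a * ?r powr p) * (?a * (w i powr ?q / S) + (p / 2) * ((z i)\<^sup>2 / ?r\<^sup>2))"
      using p S r False w[OF i] by (intro mult_left_mono Youngs_inequality_0) (auto simp: field_simps)
    finally show ?thesis .
  qed
  then have "(\<Sum>i\<in>I. (w i * \<bar>z i\<bar>) powr p)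
      \<le> (\<Sum>i\<in>I. (S powr ?a * ?r powr p) * (?a * (w i powr ?q / S) + (p / 2) * ((z i)\<^sup>2 / ?r\<^sup>2)))"
    by (rule sum_mono)
  also have "\<dots> = (S powr ?a * ?r powr p) * (?a * ((\<Sum>i\<in>I. w i powr ?q) / S) + (p / 2) * ((\<Sum>i\<in>I. (z i)\<^sup>2) / ?r\<^sup>2))"
    by (simp only: sum_distrib_left[symmetric] sum.distrib sum_divide_distrib[symmetric])
  also have "\<dots> = S powr ?a * ?r powr p"
  proof -
    have "(\<Sum>i\<in>I. (z i)\<^sup>2) = ?r\<^sup>2" by (simp add: L2_set_def sum_nonneg)
    moreover have "?a * (S / S) + (p / 2) * (?r\<^sup>2 / ?r\<^sup>2) = 1"
      using S r by (simp add: field_simps)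
    ultimately show ?thesis by (simp only: S_def[symmetric] mult_1_right)
  qed
  also have "\<dots> = (S powr (1 / p - 1 / 2) * ?r) powr p"
  proof -
    have "(1 / p - 1 / 2) * p = ?a" using p by (simp add: field_simps)
    then show ?thesis by (simp only: powr_mult powr_powr)
  qed
  finally show ?thesis
    using p by (simp add: weighted_norm_le_iff S_def)
qed

text \<open>This replaces Jensen's inequality in bounding the mean of the norm by its \<open>p\<close>-th moment: it is the
  tangent of the concave function \<open>s \<mapsto> s powr (1 / p)\<close> at \<open>s = b powr p\<close>, so taking
  means and choosing \<open>b\<close> as the \<open>L\<^sup>p\<close>-norm loses nothing.\<close>

lemma weighted_norm_le_young:
  assumes p: "1 \<le> p" and b: "b > 0"
  shows "weighted_norm p I w x \<le> b * (p - 1) / p + (\<Sum>i\<in>I. (w i * \<bar>x i\<bar>) powr p) * b powr (1 - p) / p"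
proof -
  have bern: "p * y \<le> p - 1 + y powr p" if "0 \<le> y" for y :: real
  proof (cases "y = 0")
    case False
    then have y: "y > 0" using that by simp
    have "1 + p * (y - 1) \<le> y powr p"
    proof (cases "p = 1")
      case False
      have "y powr 1 * 1 powr 0 = y" using y by simp
      have "(y powr p) powr (1 / p) * 1 powr (1 - 1 / p) \<le> (1 / p) * y powr p + (1 - 1 / p) * 1"
        using p y by (intro Youngs_inequality_0) auto
      then have "y \<le> (1 / p) * y powr p + (1 - 1 / p)" using p y by (simp add: powr_powr)
      then have "p * y \<le> p * ((1 / p) * y powr p + (1 - 1 / p))" using p by (intro mult_left_mono) auto
      also have "\<dots> = y powr p + p - 1" using p by (simp add: algebra_simps)
      finally show ?thesis by (simp add: algebra_simps)
    qed (use y in simp)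
    then show ?thesis by (simp add: algebra_simps)
  qed (use p in simp)
  let ?f = "weighted_norm p I w x"
  have "?f / b \<le> (p - 1 + (?f / b) powr p) / p"
    using bern[of "?f / b"] weighted_norm_nonneg[of p I w x] b p by (simp add: field_simps)
  then have "b * (?f / b) \<le> b * ((p - 1 + (?f / b) powr p) / p)"
    using b by (intro mult_left_mono) auto
  also have "(?f / b) powr p = (\<Sum>i\<in>I. (w i * \<bar>x i\<bar>) powr p) / b powr p"
    using p by (simp add: powr_divide weighted_norm_powr)
  also have "b * ((p - 1 + (\<Sum>i\<in>I. (w i * \<bar>x i\<bar>) powr p) / b powr p) / p)
     = b * (p - 1) / p + (\<Sum>i\<in>I. (w i * \<bar>x i\<bar>) powr p) * b powr (1 - p) / p"
    using b p by (simp add: powr_diff field_simps)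
  finally show ?thesis using b by simp
qed

section \<open>Gaussian estimates for weighted p-norms\<close>

lemma std_normal_exp_square:
  assumes s: "s < 1 / 2"
  shows "integrable std_normal_distribution (\<lambda>x. exp (s * x\<^sup>2))"
    and "(\<integral>x. exp (s * x\<^sup>2) \<partial>std_normal_distribution) = 1 / sqrt (1 - 2 * s)"
proof -
  let ?v = "1 / sqrt (1 - 2 * s)"
  have eq: "std_normal_density x * exp (s * x\<^sup>2) = ?v * normal_density 0 ?v x" for x
  proof -
    have v: "?v\<^sup>2 = 1 / (1 - 2 * s)" using s by (simp add: power_divide)
    have "exp (- x\<^sup>2 / 2) * exp (s * x\<^sup>2) = exp (- (x - 0)\<^sup>2 / (2 * ?v\<^sup>2))"
      unfolding v exp_add[symmetric] by (simp add: algebra_simps diff_divide_distrib)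
    moreover have "?v * (1 / sqrt (2 * pi * ?v\<^sup>2)) = 1 / sqrt (2 * pi)"
      unfolding v using s by (simp add: real_sqrt_divide)
    ultimately show ?thesis
      unfolding normal_density_def by (simp add: mult.assoc[symmetric])
  qed
  have v: "0 < ?v" using s by simp
  have "integrable lborel (\<lambda>x. std_normal_density x * exp (s * x\<^sup>2))"
    unfolding eq by (intro integrable_mult_right integrable_normal_density v)
  then show "integrable std_normal_distribution (\<lambda>x. exp (s * x\<^sup>2))"
    by (subst integrable_density) auto
  have "(\<integral>x. std_normal_density x * exp (s * x\<^sup>2) \<partial>lborel) = ?v * 1"
    unfolding eq integral_mult_right_zero integral_normal_density[OF v] ..
  then show "(\<integral>x. exp (s * x\<^sup>2) \<partial>std_normal_distribution) = ?v"
    by (subst integral_density) auto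
qed

lemma std_normal_abs_moment_le_1:
  assumes p: "1 \<le> p" "p < 2"
  shows "integrable std_normal_distribution (\<lambda>x. \<bar>x\<bar> powr p)"
    and "(\<integral>x. \<bar>x\<bar> powr p \<partial>std_normal_distribution) \<le> 1"
proof -
  interpret N: prob_space std_normal_distribution by (rule prob_space_normal_density) simp
  have le: "\<bar>x\<bar> powr p \<le> p / 2 * x\<^sup>2 + (1 - p / 2)" for x :: real
  proof (cases "x = 0")
    case False
    have "(x\<^sup>2) powr (p / 2) * 1 powr (1 - p / 2) \<le> p / 2 * x\<^sup>2 + (1 - p / 2) * 1"
      using p False by (intro Youngs_inequality_0) auto
    moreover have "(x\<^sup>2) powr (p / 2) = \<bar>x\<bar> powr p"
    proof -
      have "x\<^sup>2 = \<bar>x\<bar> powr 2" using False by (simp add: powr_numeral)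
      then show ?thesis by (simp only: powr_powr) simp
    qed
    ultimately show ?thesis by simp
  qed (use p in simp)
  have i: "integrable std_normal_distribution (\<lambda>x. p / 2 * x\<^sup>2 + (1 - p / 2))"
    using integrable_std_normal_distribution_moment[of 2] by auto
  show *: "integrable std_normal_distribution (\<lambda>x. \<bar>x\<bar> powr p)"
    by (rule Bochner_Integration.integrable_bound[OF i])
       (use le in \<open>auto intro!: AE_I2 order_trans[OF le] abs_ge_self\<close>)
  have "(\<integral>x. \<bar>x\<bar> powr p \<partial>std_normal_distribution) \<le> (\<integral>x. p / 2 * x\<^sup>2 + (1 - p / 2) \<partial>std_normal_distribution)"
    by (intro integral_mono * i le)
  also have "\<dots> = 1"
    using std_normal_distribution_even_moments[of 1] N.prob_space
    by (simp add: integrable_std_normal_distribution_moment fact_numeral)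
  finally show "(\<integral>x. \<bar>x\<bar> powr p \<partial>std_normal_distribution) \<le> 1" .
qed

text \<open>With \<open>q = p / 2\<close>, the bound \<open>y powr q \<le> exp (q * (y - 1))\<close> at \<open>y = x\<^sup>2 / (3 * q)\<close> compares the moment with
  the mean of \<open>exp (x\<^sup>2 / 3)\<close>, which is \<open>sqrt 3\<close>. The coefficient \<open>1 / 3\<close> leaves enough room:
  the resulting constant \<open>(3 / (2 * e)) powr (p / 2) * sqrt 3\<close> is at most \<open>1\<close> for \<open>p \<ge> 2\<close>, since
  \<open>3 * sqrt 3 \<le> 2 * e\<close>.\<close>

lemma std_normal_abs_moment_le_powr:
  assumes p: "2 \<le> p"
  shows "integrable std_normal_distribution (\<lambda>x. \<bar>x\<bar> powr p)"
    and "(\<integral>x. \<bar>x\<bar> powr p \<partial>std_normal_distribution) \<le> p powr (p / 2)"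
proof -
  let ?q = "p / 2" and ?c = "(3 / (2 * exp 1)) powr (p / 2) * p powr (p / 2)"
  have le: "\<bar>x\<bar> powr p \<le> ?c * exp (1 / 3 * x\<^sup>2)" for x :: real
  proof (cases "x = 0")
    case False
    define y where "y = x\<^sup>2 / (3 * ?q)"
    have y: "y > 0" using False p by (simp add: y_def)
    have "y \<le> exp (y - 1)" using exp_ge_add_one_self[of "y - 1"] by simp
    then have "y powr ?q \<le> exp (y - 1) powr ?q" using y p by (intro powr_mono2) auto
    also have "\<dots> = exp (- ?q) * exp (1 / 3 * x\<^sup>2)"
    proof -
      have "?q * y = 1 / 3 * x\<^sup>2" using p by (simp add: y_def)
      then have "?q * (y - 1) = - ?q + 1 / 3 * x\<^sup>2" by (simp add: right_diff_distrib)
      then show ?thesis by (simp add: powr_def exp_add[symmetric])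
    qed
    finally have yq: "y powr ?q \<le> exp (- ?q) * exp (1 / 3 * x\<^sup>2)" .
    have "\<bar>x\<bar> powr p = (x\<^sup>2) powr ?q"
    proof -
      have "x\<^sup>2 = \<bar>x\<bar> powr 2" using False by (simp add: powr_numeral)
      then show ?thesis by (simp only: powr_powr) simp
    qed
    also have "x\<^sup>2 = 3 * ?q * y" using p by (simp add: y_def)
    also have "(3 * ?q * y) powr ?q = (3 * ?q) powr ?q * y powr ?q" by (rule powr_mult)
    also have "\<dots> \<le> (3 * ?q) powr ?q * (exp (- ?q) * exp (1 / 3 * x\<^sup>2))"
      using yq by (intro mult_left_mono) auto
    also have "\<dots> = ?c * exp (1 / 3 * x\<^sup>2)"
    proof -
      have "(3 * ?q) powr ?q * exp (- ?q) = (3 * ?q) powr ?q * (1 / exp 1) powr ?q"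
        by (simp add: powr_def ln_div)
      also have "\<dots> = (3 * ?q * (1 / exp 1)) powr ?q" by (simp only: powr_mult)
      also have "3 * ?q * (1 / exp 1) = 3 / (2 * exp 1) * p" by simp
      finally have "(3 * ?q) powr ?q * exp (- ?q) = ?c" by (simp only: powr_mult)
      then show ?thesis by (simp only: mult.assoc[symmetric])
    qed
    finally show ?thesis .
  qed (use p in simp)
  have i: "integrable std_normal_distribution (\<lambda>x. ?c * exp (1 / 3 * x\<^sup>2))"
    by (intro integrable_mult_right std_normal_exp_square) simp
  show *: "integrable std_normal_distribution (\<lambda>x. \<bar>x\<bar> powr p)"
    by (rule Bochner_Integration.integrable_bound[OF i])
       (use le in \<open>auto intro!: AE_I2 order_trans[OF le] abs_ge_self\<close>)
  have "(\<integral>x. \<bar>x\<bar> powr p \<partial>std_normal_distribution) \<le> (\<integral>x. ?c * exp (1 / 3 * x\<^sup>2) \<partial>std_normal_distribution)"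
    by (intro integral_mono * i le)
  also have "\<dots> = ?c * sqrt 3"
    using std_normal_exp_square(2)[of "1/3"] by (simp add: real_sqrt_divide)
  also have "\<dots> \<le> p powr (p / 2)"
  proof -
    have e: "(2.6::real) \<le> exp 1" using abs_le_D2[OF e_approx_32] by (simp add: field_simps)
    have "(3 / (2 * exp 1)) powr (p / 2) \<le> (3 / (2 * exp 1)) powr (1::real)"
      using p e by (intro powr_mono') auto
    also have "\<dots> = 3 / (2 * exp 1)" by simp
    finally have "(3 / (2 * exp 1)) powr (p / 2) * sqrt 3 \<le> 3 / (2 * exp 1) * sqrt 3"
      by (intro mult_right_mono) auto
    also have "\<dots> \<le> 1"
    proof -
      have "sqrt 3 \<le> (1.7321::real)" by (rule real_le_lsqrt) (auto simp: power2_eq_square)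
      then have "3 * sqrt 3 \<le> 2 * exp 1" using e by simp
      then show ?thesis by simp
    qed
    finally have "(3 / (2 * exp 1)) powr (p / 2) * sqrt 3 * p powr (p / 2) \<le> 1 * p powr (p / 2)"
      by (intro mult_right_mono) auto
    then show ?thesis by (simp add: mult_ac)
  qed
  finally show "(\<integral>x. \<bar>x\<bar> powr p \<partial>std_normal_distribution) \<le> p powr (p / 2)" .
qed

lemma measurable_weighted_norm [measurable]:
  "finite I \<Longrightarrow> weighted_norm p I w \<in> borel_measurable (gaussian_product I)"
  unfolding weighted_norm_def by measurable

lemma measurable_L2_set_gaussian [measurable]:
  "finite I \<Longrightarrow> (\<lambda>x. L2_set x I) \<in> borel_measurable (gaussian_product I)"
  unfolding L2_set_def by measurable

lemma gaussian_product_component: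
  fixes h :: "real \<Rightarrow> real"
  assumes i: "i \<in> I" and h: "integrable std_normal_distribution h"
  shows "integrable (gaussian_product I) (\<lambda>x. h (x i))"
    and "(\<integral>x. h (x i) \<partial>gaussian_product I) = (\<integral>x. h x \<partial>std_normal_distribution)"
proof -
  interpret product_prob_space "\<lambda>_. std_normal_distribution" I by (rule product_prob_space_gaussian)
  have d: "distr (gaussian_product I) std_normal_distribution (\<lambda>x. x i) = std_normal_distribution"
    by (rule PiM_component[OF i])
  have [measurable]: "h \<in> borel_measurable std_normal_distribution" using h by auto
  have m: "(\<lambda>x. x i) \<in> measurable (gaussian_product I) std_normal_distribution"
    using i by measurable
  show "integrable (gaussian_product I) (\<lambda>x. h (x i))"
    using h d integrable_distr[OF m, of h] by simp
  show "(\<integral>x. h (x i) \<partial>gaussian_product I) = (\<integral>x. h x \<partial>std_normal_distribution)"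
    using integral_distr[OF m, of h] d by simp
qed

lemma weighted_norm_expectation_le:
  assumes I: "finite I" "I \<noteq> {}" and p: "1 \<le> p" and w: "\<And>i. i \<in> I \<Longrightarrow> 0 < w i"
    and int: "integrable std_normal_distribution (\<lambda>x. \<bar>x\<bar> powr p)"
    and m: "(\<integral>x. \<bar>x\<bar> powr p \<partial>std_normal_distribution) \<le> m powr p" and m0: "0 < m"
  shows "(\<integral>x. weighted_norm p I w x \<partial>gaussian_product I) \<le> m * (\<Sum>i\<in>I. w i powr p) powr (1 / p)"
proof -
  interpret product_prob_space "\<lambda>_. std_normal_distribution" I by (rule product_prob_space_gaussian)
  define S where "S = (\<Sum>i\<in>I. w i powr p)"
  have S: "S > 0" unfolding S_def using I by (intro sum_pos) (auto simp: less_imp_neq[OF w, symmetric])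
  define b where "b = m * S powr (1 / p)"
  have b: "b > 0" "b powr p = m powr p * S"
    using S m0 p by (auto simp: b_def powr_mult powr_powr)
  let ?s = "\<lambda>x. \<Sum>i\<in>I. (w i * \<bar>x i\<bar>) powr p"
  have ii: "integrable (gaussian_product I) (\<lambda>x. w i powr p * \<bar>x i\<bar> powr p)" if "i \<in> I" for i
    using gaussian_product_component(1)[OF that int] by (intro integrable_mult_right)
  have isum: "integrable (gaussian_product I) ?s"
    unfolding powr_mult by (intro Bochner_Integration.integrable_sum ii)
  have "(\<integral>x. ?s x \<partial>gaussian_product I) = (\<Sum>i\<in>I. \<integral>x. w i powr p * \<bar>x i\<bar> powr p \<partial>gaussian_product I)"
    unfolding powr_mult by (rule Bochner_Integration.integral_sum) (rule ii)
  also have "\<dots> = (\<Sum>i\<in>I. w i powr p * (\<integral>x. \<bar>x\<bar> powr p \<partial>std_normal_distribution))"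
    by (intro sum.cong refl) (simp add: gaussian_product_component(2)[OF _ int])
  also have "\<dots> \<le> (\<Sum>i\<in>I. w i powr p * m powr p)"
    using m by (intro sum_mono mult_left_mono) auto
  also have "\<dots> = b powr p" by (simp add: b S_def sum_distrib_left mult.commute)
  finally have es: "(\<integral>x. ?s x \<partial>gaussian_product I) \<le> b powr p" .
  have ib: "integrable (gaussian_product I) (\<lambda>x. b * (p - 1) / p + ?s x * b powr (1 - p) / p)"
    using isum by (intro Bochner_Integration.integrable_add integrable_divide_zero integrable_mult_left) auto
  have f: "integrable (gaussian_product I) (weighted_norm p I w)"
    by (rule Bochner_Integration.integrable_bound[OF ib])
       (use I weighted_norm_le_young[OF p b(1), of I w] weighted_norm_nonneg[of p I w]
         in \<open>auto intro!: AE_I2 order_trans[OF _ abs_ge_self]\<close>)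
  have "(\<integral>x. weighted_norm p I w x \<partial>gaussian_product I)
      \<le> (\<integral>x. b * (p - 1) / p + ?s x * b powr (1 - p) / p \<partial>gaussian_product I)"
    by (intro integral_mono f ib weighted_norm_le_young p b)
  also have "\<dots> = b * (p - 1) / p + (\<integral>x. ?s x \<partial>gaussian_product I) * b powr (1 - p) / p"
    using isum by (subst Bochner_Integration.integral_add) (auto simp: P.prob_space)
  also have "\<dots> \<le> b * (p - 1) / p + b powr p * b powr (1 - p) / p"
    using es p by (intro add_left_mono divide_right_mono mult_right_mono) auto
  also have "b powr p * b powr (1 - p) = b" using b(1) by (simp add: powr_add[symmetric])
  also have "b * (p - 1) / p + b / p = b" using p by (simp add: field_simps)
  finally show ?thesis by (simp add: b_def S_def)
qed

text \<open>Markov's inequality for \<open>exp (- (3 / 2) * (norm x)\<^sup>2)\<close>. With the coefficient \<open>3 / 2\<close> each coordinate contributes the factor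
  \<open>1 / sqrt 4 = 1 / 2 \<le> exp (- 1 / 2)\<close>, and \<open>exp (- n / 2) * exp (3 * n / 8) = exp (- n / 8)\<close>.\<close>

lemma gaussian_L2_lower_tail:
  assumes I: "finite I" "card I = n + 1"
  shows "measure (gaussian_product I) {x \<in> space (gaussian_product I). L2_set x I < sqrt (real n) / 2}
    \<le> exp (- real n / 8)"
proof -
  interpret product_prob_space "\<lambda>_. std_normal_distribution" I by (rule product_prob_space_gaussian)
  let ?e = "\<lambda>x::real. exp (- (3 / 2) * x\<^sup>2)"
  have int: "integrable std_normal_distribution ?e" "(\<integral>x. ?e x \<partial>std_normal_distribution) = 1 / 2"
    using std_normal_exp_square[of "- (3 / 2)"] by auto
  have ip: "integrable (gaussian_product I) (\<lambda>x. \<Prod>i\<in>I. ?e (x i))"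
    by (rule product_integrable_prod[OF I(1) int(1)])
  have "{x \<in> space (gaussian_product I). L2_set x I < sqrt (real n) / 2}
      \<subseteq> {x \<in> space (gaussian_product I). exp (- (3 / 8) * real n) \<le> (\<Prod>i\<in>I. ?e (x i))}"
  proof safe
    fix x assume "L2_set x I < sqrt (real n) / 2"
    then have "(L2_set x I)\<^sup>2 \<le> (sqrt (real n) / 2)\<^sup>2"
      by (intro power_mono) (auto simp: L2_set_nonneg)
    then have "(\<Sum>i\<in>I. (x i)\<^sup>2) \<le> real n / 4"
      by (simp add: L2_set_def sum_nonneg power_divide)
    then show "exp (- (3 / 8) * real n) \<le> (\<Prod>i\<in>I. ?e (x i))"
      by (simp add: exp_sum[OF I(1), symmetric] sum_negf sum_distrib_left[symmetric] sum_divide_distrib[symmetric])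
  qed
  then have "measure (gaussian_product I) {x \<in> space (gaussian_product I). L2_set x I < sqrt (real n) / 2}
      \<le> measure (gaussian_product I) {x \<in> space (gaussian_product I). exp (- (3 / 8) * real n) \<le> (\<Prod>i\<in>I. ?e (x i))}"
    using I(1) by (intro finite_measure_mono) auto
  also have "\<dots> \<le> (\<integral>x. (\<Prod>i\<in>I. ?e (x i)) \<partial>gaussian_product I) / exp (- (3 / 8) * real n)"
    by (rule integral_Markov_inequality_measure[OF ip, of "{}"]) (auto intro!: prod_nonneg)
  also have "(\<integral>x. (\<Prod>i\<in>I. ?e (x i)) \<partial>gaussian_product I) = (1 / 2) ^ (n + 1)"
    unfolding product_integral_prod[OF I(1) int(1)] int(2) using I(2) by simp
  also have "(1 / 2) ^ (n + 1) / exp (- (3 / 8) * real n) = (1 / 2) ^ (n + 1) * exp (3 / 8 * real n)"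
    by (simp add: exp_minus field_simps)
  also have "\<dots> \<le> (1 / 2) ^ n * exp (3 / 8 * real n)"
    by (intro mult_right_mono power_decreasing) auto
  also have "\<dots> \<le> exp (- 1 / 2) ^ n * exp (3 / 8 * real n)"
  proof -
    have "(1 / 2 :: real) \<le> exp (- 1 / 2)"
      using exp_ge_add_one_self[of "- 1 / 2"] by simp
    then show ?thesis by (intro mult_right_mono power_mono) auto
  qed
  also have "\<dots> = exp (- real n / 8)"
    by (simp add: exp_of_nat_mult[symmetric] exp_add[symmetric])
  finally show ?thesis .
qed

text \<open>The ratio can fall below \<open>sqrt n / (2 * (a + t * L))\<close> only if the Euclidean norm is below
  \<open>sqrt n / 2\<close> or the weighted norm is at least \<open>a + t * L\<close>.\<close>

lemma gaussian_ratio_tail: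
  assumes I: "finite I" "card I = n + 1" and p: "1 \<le> p" and w: "\<And>i. i \<in> I \<Longrightarrow> 0 < w i"
    and lip: "\<And>z. weighted_norm p I w z \<le> L * L2_set z I" and L: "0 < L"
    and a: "(\<integral>x. weighted_norm p I w x \<partial>gaussian_product I) \<le> a" and t: "0 < t"
  shows "measure (gaussian_product I) {x \<in> space (gaussian_product I).
      L2_set x I < sqrt (real n) / (2 * (a + t * L)) * weighted_norm p I w x}
    \<le> exp (- real n / 8) + exp (- t\<^sup>2 / 2)"
proof -
  interpret product_prob_space "\<lambda>_. std_normal_distribution" I by (rule product_prob_space_gaussian)
  note [measurable] = measurable_weighted_norm[OF I(1)] measurable_L2_set_gaussian[OF I(1)]
  let ?M = "gaussian_product I" and ?f = "weighted_norm p I w"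
  have "0 \<le> (\<integral>x. ?f x \<partial>?M)"
    by (intro Bochner_Integration.integral_nonneg weighted_norm_nonneg)
  then have aL: "a + t * L > 0" using a t L by (simp add: add_nonneg_pos)
  let ?A = "{x \<in> space ?M. L2_set x I < sqrt (real n) / 2}"
  let ?B = "{x \<in> space ?M. a + t * L \<le> ?f x}"
  have "measure ?M {x \<in> space ?M. L2_set x I < sqrt (real n) / (2 * (a + t * L)) * ?f x} \<le> measure ?M (?A \<union> ?B)"
  proof (intro finite_measure_mono subsetI)
    fix x assume x: "x \<in> {x \<in> space ?M. L2_set x I < sqrt (real n) / (2 * (a + t * L)) * ?f x}"
    show "x \<in> ?A \<union> ?B"
    proof (rule ccontr)
      assume "x \<notin> ?A \<union> ?B"
      then have 1: "sqrt (real n) / 2 \<le> L2_set x I" "?f x \<le> a + t * L" using x by auto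
      have "sqrt (real n) / (2 * (a + t * L)) * ?f x \<le> sqrt (real n) / (2 * (a + t * L)) * (a + t * L)"
        using 1 aL by (intro mult_left_mono) auto
      also have "\<dots> = sqrt (real n) / 2" using aL by (simp add: field_simps)
      finally show False using 1(1) x by (simp only: mem_Collect_eq) linarith
    qed
  qed measurable
  also have "\<dots> \<le> measure ?M ?A + measure ?M ?B"
    by (intro measure_Un_le) measurable
  also have "\<dots> \<le> exp (- real n / 8) + exp (- t\<^sup>2 / 2)"
  proof (intro add_mono gaussian_L2_lower_tail I gaussian_concentration L a t)
    show "\<bar>?f x - ?f y\<bar> \<le> L * L2_set (\<lambda>i. x i - y i) I" for x y
      using w by (intro weighted_norm_lipschitz p lip) (auto intro: less_imp_le)
  qed measurable
  finally show ?thesis .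
qed

section \<open>Rotation invariance of Gaussian vectors\<close>

lemma nn_integral_lborel_shift:
  fixes g :: "'a::euclidean_space \<Rightarrow> ennreal"
  assumes [measurable]: "g \<in> borel_measurable borel"
  shows "(\<integral>\<^sup>+x. g (x + c) \<partial>lborel) = (\<integral>\<^sup>+x. g x \<partial>lborel)"
proof -
  have "(\<integral>\<^sup>+x. g x \<partial>lborel) = (\<integral>\<^sup>+x. g x \<partial>distr lborel borel ((+) c))"
    by (simp add: lborel_distr_plus)
  also have "\<dots> = (\<integral>\<^sup>+x. g (c + x) \<partial>lborel)"
    by (subst nn_integral_distr) auto
  finally show ?thesis by (simp add: add.commute)
qed

lemma orthogonal_transformation_measurable:
  fixes f :: "'a::euclidean_space \<Rightarrow> 'a"
  assumes "orthogonal_transformation f"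
  shows "f \<in> borel_measurable borel"
  using assms by (intro borel_measurable_continuous_onI linear_continuous_on)
    (simp add: orthogonal_transformation_linear linear_conv_bounded_linear[symmetric])

text \<open>Let \<open>B\<close> be the unit ball. The double integral of \<open>1\<^sub>A (f z) * 1\<^sub>B (f z - x)\<close> over \<open>z\<close> and \<open>x\<close> equals the
  image measure of \<open>A\<close> times the volume of \<open>B\<close> when \<open>x\<close> is integrated first. When \<open>z\<close> is integrated
  first, the shift \<open>z \<mapsto> z + inv f x\<close> turns it into the volume of \<open>A\<close> times the image measure of \<open>B\<close>.
  As \<open>f\<close> maps \<open>B\<close> to itself, the volume of \<open>B\<close> cancels.\<close>

lemma lborel_distr_orthogonal_transformation:
  fixes f :: "'a::euclidean_space \<Rightarrow> 'a"
  assumes f: "orthogonal_transformation f"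
  shows "distr lborel borel f = lborel"
proof (rule measure_eqI)
  note fm[measurable] = orthogonal_transformation_measurable[OF f]
  note lin = orthogonal_transformation_linear[OF f]
  define h where "h = inv f"
  have fh: "f (h x) = x" for x
    unfolding h_def by (rule surj_f_inv_f[OF orthogonal_transformation_surj[OF f]])
  have hm[measurable]: "h \<in> borel_measurable borel"
    unfolding h_def by (intro orthogonal_transformation_measurable orthogonal_transformation_inv f)
  let ?B = "ball 0 1 :: 'a set"
  have B: "f x \<in> ?B \<longleftrightarrow> x \<in> ?B" "- x \<in> ?B \<longleftrightarrow> x \<in> ?B" for x
    by (simp_all add: orthogonal_transformation_norm[OF f])
  have Bm[measurable]: "?B \<in> sets borel" by simp
  fix A assume "A \<in> sets (distr lborel borel f)"
  then have A[measurable]: "A \<in> sets borel" by simp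
  let ?I = "\<integral>\<^sup>+z. \<integral>\<^sup>+x. indicator A (f z) * indicator ?B (f z - x) \<partial>lborel \<partial>lborel"
  have "(\<integral>\<^sup>+x. indicator A (f z) * indicator ?B (f z - x) \<partial>lborel) = indicator A (f z) * emeasure lborel ?B" for z
  proof -
    have "(\<integral>\<^sup>+x. indicator ?B (f z - x) \<partial>lborel) = (\<integral>\<^sup>+x. indicator ?B (x + - f z) \<partial>(lborel :: 'a measure))"
    proof (intro nn_integral_cong)
      fix x
      show "indicator ?B (f z - x) = (indicator ?B (x + - f z) :: ennreal)"
        using B(2)[of "f z - x"] by (simp add: indicator_def)
    qed
    also have "\<dots> = emeasure lborel ?B"
      by (subst nn_integral_lborel_shift) (rule borel_measurable_indicator, simp_all)
    finally have *: "(\<integral>\<^sup>+x. indicator ?B (f z - x) \<partial>lborel) = emeasure lborel ?B" .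
    show ?thesis unfolding *[symmetric] by (rule nn_integral_cmult) measurable
  qed
  then have 1: "?I = emeasure (distr lborel borel f) A * emeasure lborel ?B"
    using nn_integral_distr[of f lborel borel "indicator A"] by (simp add: nn_integral_multc)
  have "?I = (\<integral>\<^sup>+x. \<integral>\<^sup>+z. indicator A (f z) * indicator ?B (f z - x) \<partial>lborel \<partial>lborel)"
    by (rule lborel_pair.Fubini') measurable
  also have "\<dots> = (\<integral>\<^sup>+x. \<integral>\<^sup>+z. indicator A (f z + x) * indicator ?B (f z) \<partial>lborel \<partial>lborel)"
  proof (rule nn_integral_cong)
    fix x
    have "(\<integral>\<^sup>+z. indicator A (f z) * indicator ?B (f z - x) \<partial>(lborel :: 'a measure))
       = (\<integral>\<^sup>+z. indicator A (f (z + h x)) * indicator ?B (f (z + h x) - x) \<partial>lborel)"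
      by (rule nn_integral_lborel_shift[symmetric]) measurable
    then show "(\<integral>\<^sup>+z. indicator A (f z) * indicator ?B (f z - x) \<partial>lborel)
       = (\<integral>\<^sup>+z. indicator A (f z + x) * indicator ?B (f z) \<partial>lborel)"
      by (simp add: linear_add[OF lin] fh)
  qed
  also have "\<dots> = (\<integral>\<^sup>+z. \<integral>\<^sup>+x. indicator A (f z + x) * indicator ?B (f z) \<partial>lborel \<partial>lborel)"
    by (rule lborel_pair.Fubini'[symmetric]) measurable
  also have "\<dots> = (\<integral>\<^sup>+z. emeasure lborel A * indicator ?B (f z) \<partial>lborel)"
  proof (rule nn_integral_cong)
    fix z
    have "(\<integral>\<^sup>+x. indicator A (f z + x) \<partial>lborel) = emeasure lborel A"
      using nn_integral_lborel_shift[of "indicator A" "f z"] by (simp add: add.commute)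
    then show "(\<integral>\<^sup>+x. indicator A (f z + x) * indicator ?B (f z) \<partial>lborel) = emeasure lborel A * indicator ?B (f z)"
      by (simp add: nn_integral_multc)
  qed
  also have "\<dots> = emeasure lborel A * emeasure lborel ?B"
  proof -
    have "indicator ?B (f z) = (indicator ?B z :: ennreal)" for z using B(1)[of z] by (simp add: indicator_def)
    then show ?thesis by (simp add: nn_integral_cmult)
  qed
  finally have "emeasure (distr lborel borel f) A * emeasure lborel ?B = emeasure lborel A * emeasure lborel ?B"
    using 1 by simp
  moreover have "emeasure lborel ?B \<noteq> \<infinity>"
    using emeasure_lborel_ball_finite[of "0::'a" 1] by simp
  moreover have "emeasure lborel ?B \<noteq> 0"
    using content_ball_pos[of 1 "0::'a"] by (auto simp: measure_def)
  ultimately show "emeasure (distr lborel borel f) A = emeasure lborel A"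
    by (simp add: ennreal_mult_cancel_left mult.commute[of _ "emeasure lborel (ball 0 1)"])
qed simp

definition gaussian_vector :: "(real ^ 'N) measure"
  where "gaussian_vector = distr (gaussian_product UNIV) borel vec_lambda"

lemma measurable_vec_lambda_PiM:
  assumes "\<And>i. sets (M i) = sets borel"
  shows "(vec_lambda :: ('N::finite \<Rightarrow> real) \<Rightarrow> real ^ 'N) \<in> borel_measurable (Pi\<^sub>M UNIV M)"
proof -
  have [measurable]: "(\<lambda>x. x i) \<in> borel_measurable (Pi\<^sub>M UNIV M)" for i
    using measurable_component_singleton[of i UNIV M] measurable_cong_sets[OF refl assms] by blast
  have eq: "vec_lambda = (\<lambda>x. \<Sum>i\<in>UNIV. x i *\<^sub>R (axis i 1 :: real ^ 'N))"
    by (auto simp: vec_eq_iff axis_def if_distrib sum.delta cong: if_cong)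
  show ?thesis unfolding eq by measurable
qed

lemma lborel_eq_distr_vec_lambda:
  "(lborel :: (real ^ 'N) measure) = distr (\<Pi>\<^sub>M i\<in>UNIV. lborel) borel vec_lambda"
proof (rule lborel_eqI)
  interpret product_sigma_finite "\<lambda>_::'N. lborel :: real measure" by standard
  fix l u :: "real ^ 'N"
  assume lu: "\<And>b. b \<in> Basis \<Longrightarrow> l \<bullet> b \<le> u \<bullet> b"
  have le: "l $ i \<le> u $ i" for i
    using lu[of "axis i 1"] by (simp add: inner_axis axis_in_Basis_iff)
  have "emeasure (distr (\<Pi>\<^sub>M i\<in>UNIV. lborel) borel vec_lambda) (box l u)
      = emeasure (\<Pi>\<^sub>M i\<in>(UNIV::'N set). lborel) (\<Pi>\<^sub>E i\<in>UNIV. {l $ i<..<u $ i})"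
  proof -
    have "vec_lambda -` box l u \<inter> space (\<Pi>\<^sub>M i\<in>(UNIV::'N set). lborel) = (\<Pi>\<^sub>E i\<in>UNIV. {l $ i<..<u $ i})"
      by (auto simp: mem_box_cart space_PiM PiE_def Pi_iff)
    then show ?thesis
      by (subst emeasure_distr) (auto intro: measurable_vec_lambda_PiM)
  qed
  also have "\<dots> = (\<Prod>i\<in>UNIV. ennreal (u $ i - l $ i))"
    using le by (subst emeasure_PiM) auto
  also have "\<dots> = ennreal (\<Prod>i\<in>UNIV. u $ i - l $ i)"
    using le by (intro prod_ennreal) simp
  also have "(\<Prod>i\<in>UNIV. u $ i - l $ i) = (\<Prod>b\<in>Basis. (u - l) \<bullet> b)"
  proof -
    have bas: "(Basis :: (real ^ 'N) set) = (\<lambda>i. axis i 1) ` UNIV" by (auto simp: Basis_vec_def)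
    have inj: "inj (\<lambda>i::'N. axis i (1::real))" by (auto simp: inj_def axis_eq_axis)
    show ?thesis unfolding bas prod.reindex[OF inj] by (simp add: inner_axis)
  qed
  finally show "emeasure (distr (\<Pi>\<^sub>M i\<in>UNIV. lborel) borel vec_lambda) (box l u)
      = ennreal (\<Prod>b\<in>Basis. (u - l) \<bullet> b)" .
qed simp

text \<open>The product of the one-dimensional densities depends on the Euclidean norm only; this is the source
  of rotation invariance.\<close>

lemma gaussian_vector_density:
  "(gaussian_vector :: (real ^ 'N) measure)
    = density lborel (\<lambda>x. ennreal ((1 / sqrt (2 * pi)) ^ CARD('N) * exp (- (norm x)\<^sup>2 / 2)))"
proof -
  interpret L: product_sigma_finite "\<lambda>_::'N. lborel :: real measure" by standard
  interpret N: product_prob_space "\<lambda>_::'N. std_normal_distribution" by (rule product_prob_space_gaussian)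
  let ?P = "\<Pi>\<^sub>M i\<in>(UNIV::'N set). (lborel :: real measure)"
  let ?d = "\<lambda>x::'N \<Rightarrow> real. \<Prod>i\<in>UNIV. ennreal (std_normal_density (x i))"
  have sets_eq: "sets ?P = sets (gaussian_product (UNIV :: 'N set))"
    by (intro sets_PiM_cong) auto
  have "density ?P ?d = gaussian_product UNIV"
  proof (rule N.PiM_eqI)
    show "sets (density ?P ?d) = sets (gaussian_product (UNIV :: 'N set))" using sets_eq by simp
    fix A :: "'N \<Rightarrow> real set"
    assume "\<And>i. i \<in> UNIV \<Longrightarrow> A i \<in> sets std_normal_distribution"
    then have A[measurable]: "A i \<in> sets borel" for i by simp
    have "emeasure (density ?P ?d) (Pi\<^sub>E UNIV A) = (\<integral>\<^sup>+x. ?d x * indicator (Pi\<^sub>E UNIV A) x \<partial>?P)"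
      by (intro emeasure_density) (auto intro!: sets_PiM_I_finite)
    also have "\<dots> = (\<integral>\<^sup>+x. (\<Prod>i\<in>UNIV. ennreal (std_normal_density (x i)) * indicator (A i) (x i)) \<partial>?P)"
    proof (intro nn_integral_cong)
      fix x :: "'N \<Rightarrow> real"
      have "(\<Prod>i\<in>UNIV. indicator (A i) (x i) :: ennreal) = indicator (Pi\<^sub>E UNIV A) x"
        by (auto simp: indicator_def PiE_UNIV_domain Pi_iff)
      then show "?d x * indicator (Pi\<^sub>E UNIV A) x = (\<Prod>i\<in>UNIV. ennreal (std_normal_density (x i)) * indicator (A i) (x i))"
        by (simp add: prod.distrib)
    qed
    also have "\<dots> = (\<Prod>i\<in>UNIV. \<integral>\<^sup>+x. ennreal (std_normal_density x) * indicator (A i) x \<partial>lborel)"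
      by (rule L.product_nn_integral_prod) auto
    also have "\<dots> = (\<Prod>i\<in>UNIV. emeasure std_normal_distribution (A i))"
      by (intro prod.cong refl) (simp add: emeasure_density)
    finally show "emeasure (density ?P ?d) (Pi\<^sub>E UNIV A) = (\<Prod>i\<in>UNIV. emeasure std_normal_distribution (A i))" .
  qed simp
  then have "(gaussian_vector :: (real ^ 'N) measure) = distr (density ?P ?d) borel vec_lambda"
    by (simp add: gaussian_vector_def)
  also have "?d = (\<lambda>x. ennreal ((1 / sqrt (2 * pi)) ^ CARD('N) * exp (- (norm (vec_lambda x :: real ^ 'N))\<^sup>2 / 2)))"
  proof
    fix x :: "'N \<Rightarrow> real"
    have "?d x = ennreal (\<Prod>i\<in>UNIV. std_normal_density (x i))" by (intro prod_ennreal) simp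
    also have "(\<Prod>i\<in>UNIV. std_normal_density (x i)) = (1 / sqrt (2 * pi)) ^ CARD('N) * exp (\<Sum>i\<in>UNIV. - (x i)\<^sup>2 / 2)"
      unfolding std_normal_density_def by (simp only: prod.distrib prod_constant exp_sum finite_UNIV finite)
    also have "(\<Sum>i\<in>UNIV. - (x i)\<^sup>2 / 2) = - (norm (vec_lambda x :: real ^ 'N))\<^sup>2 / 2"
      by (simp add: norm_vec_def L2_set_def sum_nonneg sum_negf sum_divide_distrib)
    finally show "?d x = ennreal ((1 / sqrt (2 * pi)) ^ CARD('N) * exp (- (norm (vec_lambda x :: real ^ 'N))\<^sup>2 / 2))" .
  qed
  also have "distr (density ?P (\<lambda>x. ennreal ((1 / sqrt (2 * pi)) ^ CARD('N) * exp (- (norm (vec_lambda x :: real ^ 'N))\<^sup>2 / 2)))) borel vec_lambda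
      = density (distr ?P borel vec_lambda) (\<lambda>x. ennreal ((1 / sqrt (2 * pi)) ^ CARD('N) * exp (- (norm (x :: real ^ 'N))\<^sup>2 / 2)))"
    by (intro density_distr[symmetric] measurable_vec_lambda_PiM) auto
  finally show ?thesis by (simp add: lborel_eq_distr_vec_lambda)
qed

lemma sets_gaussian_vector [simp, measurable_cong]: "sets gaussian_vector = sets borel"
  by (simp add: gaussian_vector_def)

lemma space_gaussian_vector [simp]: "space gaussian_vector = UNIV"
  by (simp add: gaussian_vector_def)

lemma prob_space_gaussian_vector: "prob_space (gaussian_vector :: (real ^ 'N) measure)"
proof -
  interpret N: product_prob_space "\<lambda>_::'N. std_normal_distribution" UNIV by (rule product_prob_space_gaussian)
  show ?thesis
    unfolding gaussian_vector_def by (intro N.P.prob_space_distr measurable_vec_lambda_PiM) simp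
qed

lemma gaussian_vector_rotation_invariant:
  fixes f :: "real ^ 'N \<Rightarrow> real ^ 'N"
  assumes f: "orthogonal_transformation f"
  shows "distr gaussian_vector borel f = (gaussian_vector :: (real ^ 'N) measure)"
proof -
  note [measurable] = orthogonal_transformation_measurable[OF f]
  let ?d = "\<lambda>x::real ^ 'N. ennreal ((1 / sqrt (2 * pi)) ^ CARD('N) * exp (- (norm x)\<^sup>2 / 2))"
  have "distr gaussian_vector borel f = distr (density lborel (\<lambda>x. ?d (f x))) borel f"
    by (simp add: gaussian_vector_density orthogonal_transformation_norm[OF f])
  also have "\<dots> = density (distr lborel borel f) ?d"
    by (intro density_distr[symmetric]) auto
  finally show ?thesis
    by (simp add: lborel_distr_orthogonal_transformation[OF f] gaussian_vector_density)
qed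

lemma nn_integral_gaussian_vector_rotate:
  fixes f :: "real ^ 'N \<Rightarrow> real ^ 'N" and g :: "real ^ 'N \<Rightarrow> ennreal"
  assumes f: "orthogonal_transformation f" and [measurable]: "g \<in> borel_measurable borel"
  shows "(\<integral>\<^sup>+x. g (f x) \<partial>gaussian_vector) = (\<integral>\<^sup>+x. g x \<partial>gaussian_vector)"
proof -
  note [measurable] = orthogonal_transformation_measurable[OF f]
  have "(\<integral>\<^sup>+x. g x \<partial>gaussian_vector) = (\<integral>\<^sup>+x. g x \<partial>distr gaussian_vector borel f)"
    by (simp add: gaussian_vector_rotation_invariant[OF f])
  also have "\<dots> = (\<integral>\<^sup>+x. g (f x) \<partial>gaussian_vector)"
    by (rule nn_integral_distr) auto
  finally show ?thesis ..
qed

lemma gaussian_vector_open_pos: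
  fixes U :: "(real ^ 'N) set"
  assumes U: "open U" "x \<in> U"
  shows "emeasure gaussian_vector U \<noteq> 0"
proof
  have [measurable]: "U \<in> sets borel" using U by simp
  assume "emeasure gaussian_vector U = 0"
  then have "AE y in lborel. y \<in> U \<longrightarrow> False"
    by (subst (asm) gaussian_vector_density, subst (asm) emeasure_density)
       (auto simp: nn_integral_0_iff_AE indicator_def not_le split: if_splits elim: eventually_mono)
  then have "emeasure lborel U = 0"
    by (subst (asm) AE_iff_measurable[of U]) auto
  moreover obtain e where e: "e > 0" "ball x e \<subseteq> U" using U openE by blast
  ultimately have "emeasure lborel (ball x e) = 0"
    using emeasure_mono[of "ball x e" U lborel] by simp
  then show False
    using content_ball_pos[OF e(1), of x] by (simp add: measure_def)
qed

lemma gaussian_vector_coordinate_nonzero: "emeasure gaussian_vector {x :: real ^ 'N. x $ i = 0} = 0"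
proof -
  have "AE x in lborel. x \<bullet> axis i (1::real) \<noteq> 0"
    by (rule AE_lborel_inner_neq) (auto simp: axis_in_Basis_iff)
  then have "AE x :: real ^ 'N in gaussian_vector. x $ i \<noteq> 0"
    unfolding gaussian_vector_density by (subst AE_density) (auto simp: inner_axis elim: eventually_mono)
  then show ?thesis
    by (subst (asm) AE_iff_measurable[of "{x. x $ i = 0}"]) auto
qed

section \<open>Projections and invariance on the Grassmannian\<close>

lemma closest_point_subspace_eq:
  fixes E :: "'a::euclidean_space set"
  assumes E: "subspace E" and y: "y \<in> E" and z: "\<And>w. w \<in> E \<Longrightarrow> (x - y) \<bullet> w = 0"
  shows "closest_point E x = y"
proof -
  have "dist x y \<le> dist x w" if w: "w \<in> E" for w
  proof -
    have "(x - y) \<bullet> (y - w) = 0" using z subspace_diff[OF E y w] by blast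
    then have "(norm (x - w))\<^sup>2 = (norm (x - y))\<^sup>2 + (norm (y - w))\<^sup>2"
      using norm_add_Pythagorean[of "x - y" "y - w"] by (simp add: orthogonal_def)
    then have "(norm (x - y))\<^sup>2 \<le> (norm (x - w))\<^sup>2" by simp
    then show ?thesis by (simp add: dist_norm)
  qed
  then show ?thesis
    using closest_point_unique[OF subspace_imp_convex[OF E] closed_subspace[OF E] y, of x] by auto
qed

lemma closest_point_subspace:
  fixes E :: "'a::euclidean_space set"
  assumes E: "subspace E"
  shows "closest_point E x \<in> E" and "w \<in> E \<Longrightarrow> (x - closest_point E x) \<bullet> w = 0"
proof -
  obtain y z where yz: "y \<in> span E" "\<And>w. w \<in> span E \<Longrightarrow> orthogonal z w" "x = y + z"
    using orthogonal_subspace_decomp_exists[of E x] by blast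
  have sE: "span E = E" using E by (simp only: span_eq_iff)
  have "closest_point E x = y"
    using yz E unfolding sE by (intro closest_point_subspace_eq) (auto simp: orthogonal_def)
  with yz E show "closest_point E x \<in> E" "w \<in> E \<Longrightarrow> (x - closest_point E x) \<bullet> w = 0"
    unfolding sE by (auto simp: orthogonal_def)
qed

lemma linear_closest_point_subspace:
  fixes E :: "'a::euclidean_space set"
  assumes E: "subspace E"
  shows "linear (closest_point E)"
proof (rule linearI)
  note cp = closest_point_subspace[OF E]
  show "closest_point E (x + y) = closest_point E x + closest_point E y" for x y
  proof (rule closest_point_subspace_eq[OF E])
    show "(x + y - (closest_point E x + closest_point E y)) \<bullet> w = 0" if "w \<in> E" for w
      using cp(2)[OF that, of x] cp(2)[OF that, of y] by (simp add: inner_add_left inner_diff_left)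
  qed (use cp(1) E in \<open>auto intro: subspace_add\<close>)
  show "closest_point E (c *\<^sub>R x) = c *\<^sub>R closest_point E x" for c x
  proof (rule closest_point_subspace_eq[OF E])
    show "(c *\<^sub>R x - c *\<^sub>R closest_point E x) \<bullet> w = 0" if "w \<in> E" for w
      using cp(2)[OF that, of x] by (simp add: scaleR_diff_right[symmetric])
  qed (use cp(1) E in \<open>auto intro: subspace_scale\<close>)
qed

text \<open>This expresses membership by the matrix that generates the sigma-algebra of the Grassmannian, so that
  conditions on \<open>E\<close> become conditions on matrices.\<close>

lemma mem_subspace_iff_projection:
  fixes E :: "(real ^ 'N) set"
  assumes E: "subspace E"
  shows "y \<in> E \<longleftrightarrow> matrix (closest_point E) *v y = y"
proof -
  have "matrix (closest_point E) *v y = closest_point E y"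
    using matrix_vector_mul(2)[OF linear_closest_point_subspace[OF E]] by (rule fun_cong)
  moreover have "E \<noteq> {}" using subspace_0[OF E] by blast
  ultimately show ?thesis
    using closest_point_refl[OF closed_subspace[OF E], of y] by simp
qed

lemma matrix_closest_point_orthogonal_image:
  fixes Q :: "real ^ 'N \<Rightarrow> real ^ 'N"
  assumes Q: "orthogonal_transformation Q" and E: "subspace E"
  shows "matrix (closest_point (Q ` E)) = matrix Q ** matrix (closest_point E) ** matrix (inv Q)"
proof -
  note lin = orthogonal_transformation_linear[OF Q]
  have lini: "linear (inv Q)" by (intro orthogonal_transformation_linear orthogonal_transformation_inv Q)
  have QE: "subspace (Q ` E)" by (rule linear_subspace_image[OF lin E])
  have QQ: "Q (inv Q x) = x" for x
    by (rule surj_f_inv_f[OF orthogonal_transformation_surj[OF Q]])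
  have "closest_point (Q ` E) x = Q (closest_point E (inv Q x))" for x
  proof (rule closest_point_subspace_eq[OF QE])
    show "Q (closest_point E (inv Q x)) \<in> Q ` E" using closest_point_subspace(1)[OF E] by blast
    fix w assume "w \<in> Q ` E"
    then obtain v where v: "v \<in> E" "w = Q v" by blast
    have "(x - Q (closest_point E (inv Q x))) \<bullet> w = Q (inv Q x - closest_point E (inv Q x)) \<bullet> Q v"
      by (simp add: linear_diff[OF lin] QQ v)
    also have "\<dots> = (inv Q x - closest_point E (inv Q x)) \<bullet> v"
      using Q by (simp add: orthogonal_transformation_def)
    also have "\<dots> = 0" by (rule closest_point_subspace(2)[OF E v(1)])
    finally show "(x - Q (closest_point E (inv Q x))) \<bullet> w = 0" .
  qed
  then have eq: "closest_point (Q ` E) = Q \<circ> (closest_point E \<circ> inv Q)" by auto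
  have "matrix (closest_point (Q ` E)) = matrix Q ** (matrix (closest_point E) ** matrix (inv Q))"
    unfolding eq using lin lini linear_closest_point_subspace[OF E]
    by (simp add: matrix_compose linear_compose)
  then show ?thesis by (simp add: matrix_mul_assoc)
qed

lemma space_grassmannian: "space (grassmannian k) = {E. subspace E \<and> dim E = k}"
  by (simp add: grassmannian_def)

lemma measurable_grassmannian_projection:
  "(\<lambda>E. matrix (closest_point E)) \<in> borel_measurable (grassmannian k)"
  unfolding grassmannian_def by (rule measurable_vimage_algebra1) simp

lemma measurable_orthogonal_image:
  fixes Q :: "real ^ 'N \<Rightarrow> real ^ 'N"
  assumes Q: "orthogonal_transformation Q"
  shows "(`) Q \<in> measurable (grassmannian k) (grassmannian k)"
proof -
  note lin = orthogonal_transformation_linear[OF Q]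
  have inj: "inj Q" by (rule orthogonal_transformation_inj[OF Q])
  have "(\<lambda>E. matrix (closest_point (Q ` E))) \<in> borel_measurable (grassmannian k)"
  proof (subst measurable_cong)
    show "matrix (closest_point (Q ` E)) = matrix Q ** matrix (closest_point E) ** matrix (inv Q)"
      if "E \<in> space (grassmannian k)" for E :: "(real ^ 'N) set"
      using that by (intro matrix_closest_point_orthogonal_image Q) (simp add: space_grassmannian)
    have "continuous_on UNIV (\<lambda>M. matrix Q ** M ** matrix (inv Q))"
      unfolding matrix_matrix_mult_def by (intro continuous_intros)
    from measurable_compose[OF measurable_grassmannian_projection borel_measurable_continuous_onI[OF this]]
    show "(\<lambda>E. matrix Q ** matrix (closest_point E) ** matrix (inv Q)) \<in> borel_measurable (grassmannian k)" .
  qed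
  moreover have "(`) Q \<in> space (grassmannian k) \<rightarrow> {E. subspace E \<and> dim E = k}"
    by (auto simp: space_grassmannian linear_subspace_image[OF lin] dim_image_eq[OF lin inj_on_subset[OF inj subset_UNIV]])
  ultimately show ?thesis
    unfolding grassmannian_def[of k, abs_def] by (intro measurable_vimage_algebra2) (auto simp: grassmannian_def)
qed

text \<open>The invariance of \<open>\<mu>\<close> is postulated for images of events; passing to the inverse of \<open>Q\<close> gives it
  for preimages, the form needed for substitution in integrals.\<close>

lemma grassmann_haar_distr:
  fixes Q :: "real ^ 'N \<Rightarrow> real ^ 'N"
  assumes \<mu>: "grassmann_haar k \<mu>" and Q: "orthogonal_transformation Q"
  shows "(`) Q \<in> measurable \<mu> \<mu>" "distr \<mu> \<mu> ((`) Q) = \<mu>"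
proof -
  have sets: "sets \<mu> = sets (grassmannian k)" using \<mu> by (simp add: grassmann_haar_def)
  note space = sets_eq_imp_space_eq[OF sets]
  show m: "(`) Q \<in> measurable \<mu> \<mu>"
    using measurable_orthogonal_image[OF Q] measurable_cong_sets[OF sets sets] by blast
  have inv: "inj Q" "surj Q"
    using orthogonal_transformation_inj[OF Q] orthogonal_transformation_surj[OF Q] .
  note Q' = orthogonal_transformation_inv[OF Q]
  show "distr \<mu> \<mu> ((`) Q) = \<mu>"
  proof (rule measure_eqI)
    fix A assume "A \<in> sets (distr \<mu> \<mu> ((`) Q))"
    then have A: "A \<in> sets \<mu>" by simp
    have "(`) Q -` A \<inter> space \<mu> = (\<lambda>E. inv Q ` E) ` A"
    proof (intro set_eqI iffI)
      fix E assume "E \<in> (`) Q -` A \<inter> space \<mu>"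
      then have "Q ` E \<in> A" by simp
      moreover have "E = inv Q ` (Q ` E)" using inv by (simp add: image_comp)
      ultimately show "E \<in> (\<lambda>E. inv Q ` E) ` A" by (rule rev_image_eqI)
    next
      fix E assume "E \<in> (\<lambda>E. inv Q ` E) ` A"
      then obtain E' where E': "E' \<in> A" "E = inv Q ` E'" by blast
      have "Q ` E = E'" using E'(2) inv by (simp add: image_comp surj_iff)
      moreover have "E \<in> space \<mu>"
        using measurable_space[OF measurable_orthogonal_image[OF Q', of k], of E'] sets.sets_into_space[OF A] E' space
        by auto
      ultimately show "E \<in> (`) Q -` A \<inter> space \<mu>" using E'(1) by simp
    qed
    then have "emeasure (distr \<mu> \<mu> ((`) Q)) A = emeasure \<mu> ((\<lambda>E. inv Q ` E) ` A)"
      using emeasure_distr[OF m A] by simp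
    also have "\<dots> = emeasure \<mu> A" using \<mu> Q' A by (simp add: grassmann_haar_def)
    finally show "emeasure (distr \<mu> \<mu> ((`) Q)) A = emeasure \<mu> A" .
  qed simp
qed

definition coord_proj :: "'N set \<Rightarrow> real ^ 'N \<Rightarrow> real ^ 'N"
  where "coord_proj J x = (\<chi> i. if i \<in> J then x $ i else 0)"

lemma coord_proj_idem [simp]: "coord_proj J (coord_proj J x) = coord_proj J x"
  by (simp add: coord_proj_def vec_eq_iff)

lemma coord_proj_scale [simp]: "coord_proj J (c *\<^sub>R x) = c *\<^sub>R coord_proj J x"
  by (simp add: coord_proj_def vec_eq_iff)

lemma coord_proj_diff: "coord_proj J (x - y) = coord_proj J x - coord_proj J y"
  by (simp add: coord_proj_def vec_eq_iff)

lemma coord_proj_nth: "coord_proj J x $ i = (if i \<in> J then x $ i else 0)"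
  by (simp add: coord_proj_def)

lemma coord_proj_inner:
  assumes "coord_proj J a = a"
  shows "coord_proj J x \<bullet> a = x \<bullet> a"
proof -
  have "a $ i = 0" if "i \<notin> J" for i
    using that assms coord_proj_nth[of J a i] by simp
  then show ?thesis
    unfolding inner_vec_def by (intro sum.cong refl) (auto simp: coord_proj_nth)
qed

lemma continuous_on_coord_proj [continuous_intros]:
  assumes "continuous_on S f"
  shows "continuous_on S (\<lambda>x. coord_proj J (f x))"
proof -
  have eq: "coord_proj J = (\<lambda>x. \<chi> i. (if i \<in> J then 1 else 0) * x $ i)"
    by (auto simp: coord_proj_def vec_eq_iff)
  show ?thesis unfolding eq by (intro continuous_intros assms)
qed

lemma exists_unit_vector_in_section:
  fixes E :: "(real ^ 'N) set"
  assumes E: "subspace E" and dim: "CARD('N) < dim E + card J"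
  obtains y where "y \<in> E" "coord_proj J y = y" "norm y = 1"
proof -
  let ?F = "{x :: real ^ 'N. \<forall>i. i \<notin> J \<longrightarrow> x $ i = 0}"
  have F: "subspace ?F" by (auto simp: subspace_def)
  have "dim {x + y |x y. x \<in> E \<and> y \<in> ?F} + dim (E \<inter> ?F) = dim E + dim ?F"
    by (rule dim_sums_Int[OF E F])
  moreover have "dim ?F = card J" using dim_substandard_cart[where 'a=real, of J] by (simp only: dim_vec_eq)
  moreover have "dim {x + y |x y. x \<in> E \<and> y \<in> ?F} \<le> CARD('N)" by (rule dim_subset_UNIV_cart)
  ultimately have "dim (E \<inter> ?F) \<noteq> 0" using dim by linarith
  then obtain y where y: "y \<in> E" "y \<in> ?F" "y \<noteq> 0" by auto
  show ?thesis
  proof (rule that)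
    show "(1 / norm y) *\<^sub>R y \<in> E" using E y by (intro subspace_scale)
    have "coord_proj J y = y" using y by (auto simp: coord_proj_def vec_eq_iff)
    then show "coord_proj J ((1 / norm y) *\<^sub>R y) = (1 / norm y) *\<^sub>R y" by simp
    show "norm ((1 / norm y) *\<^sub>R y) = 1" using y by simp
  qed
qed

text \<open>The reflection in the hyperplane orthogonal to \<open>a = u - v\<close> swaps \<open>u\<close> and \<open>v\<close>. As \<open>a\<close> lies in the
  coordinate subspace, it commutes with the coordinate projection. Reflections suffice to act
  transitively on the unit sphere of the coordinate subspace.\<close>

lemma exists_reflection:
  fixes u v :: "real ^ 'N"
  assumes u: "coord_proj J u = u" and v: "coord_proj J v = v" and n: "norm u = norm v"
  obtains Q where "orthogonal_transformation Q" "Q u = v" "\<And>x. Q (Q x) = x"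
    "\<And>x. coord_proj J (Q x) = Q (coord_proj J x)"
proof (cases "u = v")
  case True
  then show ?thesis by (intro that[of "\<lambda>x. x"]) auto
next
  case False
  define a where "a = u - v"
  have a: "a \<bullet> a \<noteq> 0" "coord_proj J a = a" using False u v by (auto simp: a_def coord_proj_diff)
  define Q where "Q x = x - (2 * (x \<bullet> a) / (a \<bullet> a)) *\<^sub>R a" for x
  show ?thesis
  proof (rule that)
    have "linear Q"
      by (rule linearI) (simp_all add: Q_def inner_add_left add_divide_distrib distrib_left scaleR_add_left scaleR_diff_right)
    moreover have "Q x \<bullet> Q y = x \<bullet> y" for x y
    proof -
      define c d where "c = 2 * (x \<bullet> a) / (a \<bullet> a)" and "d = 2 * (y \<bullet> a) / (a \<bullet> a)"
      have 1: "Q x \<bullet> Q y = x \<bullet> y - d * (x \<bullet> a) - c * (y \<bullet> a) + d * (c * (a \<bullet> a))"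
        unfolding Q_def c_def[symmetric] d_def[symmetric]
        by (simp add: inner_diff_left inner_diff_right inner_commute[of a y] algebra_simps)
      have 2: "c * (a \<bullet> a) = 2 * (x \<bullet> a)" using a(1) by (simp add: c_def)
      have 3: "c * (y \<bullet> a) = d * (x \<bullet> a)" by (simp add: c_def d_def)
      show ?thesis unfolding 1 2 3 by simp
    qed
    ultimately show "orthogonal_transformation Q" by (simp add: orthogonal_transformation_def)
    have uv: "u \<bullet> u = v \<bullet> v" using n by (simp add: norm_eq)
    then have "2 * (u \<bullet> a) = a \<bullet> a"
      by (simp add: a_def inner_diff_left inner_diff_right inner_commute)
    then show "Q u = v" using a(1) by (simp add: Q_def) (simp add: a_def)
    show "Q (Q x) = x" for x
      using a(1) by (simp add: Q_def inner_diff_left diff_divide_distrib algebra_simps)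
    show "coord_proj J (Q x) = Q (coord_proj J x)" for x
      by (simp add: Q_def coord_proj_diff a(2) coord_proj_inner[OF a(2)])
  qed
qed

section \<open>Comparison of random sections with Gaussian vectors\<close>

text \<open>Existence of \<open>y\<close> in a compact set subject to a closed condition is a closed condition. For the matrix of the projection onto \<open>E\<close>, the equation
  \<open>M *v y = y\<close> says that \<open>y\<close> belongs to \<open>E\<close>.\<close>

lemma section_kernel_borel:
  fixes r :: real and J :: "'N::finite set"
  defines "Y \<equiv> {y :: real ^ 'N. coord_proj J y = y \<and> norm y = 1}"
  shows "{z :: (real ^ 'N ^ 'N) \<times> (real ^ 'N). coord_proj J (snd z) \<noteq> 0 \<and>
      (\<exists>y\<in>Y. fst z *v y = y \<and>
        norm (coord_proj J (snd z) - norm (coord_proj J (snd z)) *\<^sub>R y) \<le> r * norm (coord_proj J (snd z)))} \<in> sets borel"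
proof -
  have "closed Y" unfolding Y_def Collect_conj_eq
    by (intro closed_Int closed_Collect_eq continuous_intros)
  moreover have "bounded Y" unfolding Y_def bounded_iff by auto
  ultimately have Y: "compact Y" by (simp add: compact_eq_bounded_closed)
  let ?T = "{w :: (real ^ 'N) \<times> (real ^ 'N ^ 'N) \<times> (real ^ 'N). fst (snd w) *v fst w = fst w \<and>
    norm (coord_proj J (snd (snd w)) - norm (coord_proj J (snd (snd w))) *\<^sub>R fst w) \<le> r * norm (coord_proj J (snd (snd w)))}"
  have "closed ?T"
    unfolding Collect_conj_eq matrix_vector_mult_def
    by (intro closed_Int closed_Collect_eq closed_Collect_le continuous_intros)
  from closed_compact_projection[OF Y this]
  have "closed {z. \<exists>y. y \<in> Y \<and> fst z *v y = y \<and>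
        norm (coord_proj J (snd z) - norm (coord_proj J (snd z)) *\<^sub>R y) \<le> r * norm (coord_proj J (snd z))}"
    by simp
  moreover have "open {z :: (real ^ 'N ^ 'N) \<times> (real ^ 'N). coord_proj J (snd z) \<noteq> 0}"
    by (intro open_Collect_neq continuous_intros)
  ultimately show ?thesis
    unfolding Collect_conj_eq by (intro sets.Int) (auto simp: Bex_def)
qed

text \<open>Here \<open>P\<close> is a property of unit vectors of the coordinate subspace \<open>F\<close> that holds in the
  \<open>r\<close>-neighbourhood of all unit vectors of \<open>E \<inter> F\<close>, for each \<open>E \<in> S\<close>. Let \<open>W E x\<close> say that the
  direction of the projection of \<open>x\<close> to \<open>F\<close> has distance at most \<open>r\<close> from a unit vector of \<open>E \<inter> F\<close>,
  and let \<open>A E > 0\<close> be the Gaussian measure of \<open>{x. W E x}\<close>. The kernel \<open>1\<^sub>W / A\<close> has integral \<open>1\<close> over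
  \<open>x\<close> for each \<open>E\<close>. Its integral \<open>D x\<close> over \<open>E\<close> is unchanged by reflections that preserve \<open>F\<close>, hence does
  not depend on \<open>x\<close> as long as \<open>x\<close> has a nonzero projection, and Fubini's theorem shows that
  it equals \<open>1\<close>. So the kernel spreads the mass of \<open>\<mu>\<close> exactly into the Gaussian
  measure; the mass of \<open>S\<close> lands among the vectors whose direction satisfies \<open>P\<close>.\<close>

theorem grassmann_haar_section_le_gaussian:
  fixes \<mu> :: "(real ^ 'N) set measure"
  assumes \<mu>: "grassmann_haar k \<mu>" and J: "CARD('N) < k + card J" and r: "0 < r"
    and S: "S \<in> sets \<mu>" and B: "{x. coord_proj J x \<noteq> 0 \<and> P ((1 / norm (coord_proj J x)) *\<^sub>R coord_proj J x)} \<in> sets borel"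
    and near: "\<And>E y z. E \<in> S \<Longrightarrow> y \<in> E \<Longrightarrow> coord_proj J y = y \<Longrightarrow> norm y = 1 \<Longrightarrow>
      coord_proj J z = z \<Longrightarrow> norm z = 1 \<Longrightarrow> norm (z - y) \<le> r \<Longrightarrow> P z"
  shows "emeasure \<mu> S \<le> emeasure gaussian_vector
    {x. coord_proj J x \<noteq> 0 \<and> P ((1 / norm (coord_proj J x)) *\<^sub>R coord_proj J x)}"
proof -
  interpret \<mu>: prob_space \<mu> using \<mu> by (simp add: grassmann_haar_def)
  interpret \<gamma>: prob_space "gaussian_vector :: (real ^ 'N) measure" by (rule prob_space_gaussian_vector)
  interpret pair_sigma_finite \<mu> "gaussian_vector :: (real ^ 'N) measure" by standard
  have sets: "sets \<mu> = sets (grassmannian k)" using \<mu> by (simp add: grassmann_haar_def)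
  have space: "space \<mu> = {E. subspace E \<and> dim E = k}"
    using sets_eq_imp_space_eq[OF sets] by (simp add: space_grassmannian)
  let ?\<pi> = "coord_proj J"
  let ?B = "{x. ?\<pi> x \<noteq> 0 \<and> P ((1 / norm (?\<pi> x)) *\<^sub>R ?\<pi> x)}"
  define W where "W E x \<longleftrightarrow> ?\<pi> x \<noteq> 0 \<and> (\<exists>y\<in>E. ?\<pi> y = y \<and> norm y = 1 \<and>
    norm (?\<pi> x - norm (?\<pi> x) *\<^sub>R y) \<le> r * norm (?\<pi> x))" for E x
  have [measurable]: "Measurable.pred (\<mu> \<Otimes>\<^sub>M borel) (\<lambda>(E, x). W E x)"
  proof -
    let ?C = "{z :: (real ^ 'N ^ 'N) \<times> (real ^ 'N). ?\<pi> (snd z) \<noteq> 0 \<and>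
      (\<exists>y\<in>{y. ?\<pi> y = y \<and> norm y = 1}. fst z *v y = y \<and>
        norm (?\<pi> (snd z) - norm (?\<pi> (snd z)) *\<^sub>R y) \<le> r * norm (?\<pi> (snd z)))}"
    have C: "?C \<in> sets (borel \<Otimes>\<^sub>M borel)"
      unfolding borel_prod by (rule section_kernel_borel)
    have mproj: "(\<lambda>E. matrix (closest_point E)) \<in> borel_measurable \<mu>"
      using measurable_grassmannian_projection[of k] measurable_cong_sets[OF sets refl] by blast
    have "(\<lambda>z. (matrix (closest_point (fst z)), snd z)) \<in> measurable (\<mu> \<Otimes>\<^sub>M borel) (borel \<Otimes>\<^sub>M (borel :: (real ^ 'N) measure))"
      using mproj by measurable
    from measurable_sets[OF this C]
    have "(\<lambda>z. (matrix (closest_point (fst z)), snd z)) -` ?C \<inter> space (\<mu> \<Otimes>\<^sub>M borel) \<in> sets (\<mu> \<Otimes>\<^sub>M borel)" .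
    also have "(\<lambda>z. (matrix (closest_point (fst z)), snd z)) -` ?C \<inter> space (\<mu> \<Otimes>\<^sub>M borel)
        = {z \<in> space (\<mu> \<Otimes>\<^sub>M borel). case z of (E, x) \<Rightarrow> W E x}"
      by (auto simp: space_pair_measure space W_def mem_subspace_iff_projection)
    finally show ?thesis by (simp add: pred_def)
  qed
  define w where "w E x = (indicator {(E, x). W E x} (E, x) :: ennreal)" for E x
  have w_simp: "w E x = (if W E x then 1 else 0)" for E x by (simp add: w_def)
  have wm[measurable]: "(\<lambda>(E, x). w E x) \<in> borel_measurable (\<mu> \<Otimes>\<^sub>M borel)"
    unfolding w_simp by measurable
  have pair_sets: "sets (\<mu> \<Otimes>\<^sub>M gaussian_vector) = sets (\<mu> \<Otimes>\<^sub>M (borel :: (real ^ 'N) measure))"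
    by (intro sets_pair_measure_cong) simp_all
  have wmg: "(\<lambda>(E, x). w E x) \<in> borel_measurable (\<mu> \<Otimes>\<^sub>M gaussian_vector)"
    using wm measurable_cong_sets[OF pair_sets refl] by blast
  have wm2[measurable]: "w E \<in> borel_measurable borel" if "E \<in> space \<mu>" for E
    using measurable_compose[OF measurable_Pair1'[OF that] wm] by simp
  define A where "A E = (\<integral>\<^sup>+x. w E x \<partial>gaussian_vector)" for E
  have Am[measurable]: "A \<in> borel_measurable \<mu>"
    unfolding A_def by (rule \<gamma>.borel_measurable_nn_integral) (rule wmg)
  have A_pos: "A E \<noteq> 0" if E: "E \<in> space \<mu>" for E
  proof -
    obtain y where y: "y \<in> E" "?\<pi> y = y" "norm y = 1"
      using exists_unit_vector_in_section[of E J] E J by (auto simp: space)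
    let ?U = "{x. ?\<pi> x \<noteq> 0} \<inter> {x. norm (?\<pi> x - norm (?\<pi> x) *\<^sub>R y) < r * norm (?\<pi> x)}"
    have "open ?U" by (intro open_Int open_Collect_neq open_Collect_less continuous_intros)
    moreover have "y \<in> ?U" using y r by auto
    ultimately have "emeasure gaussian_vector ?U \<noteq> 0" by (rule gaussian_vector_open_pos)
    moreover have "emeasure gaussian_vector ?U \<le> A E"
    proof -
      have "emeasure gaussian_vector ?U = (\<integral>\<^sup>+x. indicator ?U x \<partial>gaussian_vector)"
        using \<open>open ?U\<close> by simp
      also have "\<dots> \<le> A E"
        unfolding A_def
      proof (rule nn_integral_mono)
        fix x show "indicator ?U x \<le> w E x"
          using y by (auto simp: indicator_def w_simp W_def intro!: bexI[of _ y])
      qed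
      finally show ?thesis .
    qed
    ultimately show ?thesis by auto
  qed
  have A_fin: "A E \<noteq> \<infinity>" for E
  proof -
    have "A E \<le> (\<integral>\<^sup>+x. 1 \<partial>(gaussian_vector :: (real ^ 'N) measure))"
      unfolding A_def by (rule nn_integral_mono) (simp add: w_simp)
    then show ?thesis by (auto simp: \<gamma>.emeasure_space_1 top_unique)
  qed
  define D where "D x = (\<integral>\<^sup>+E. w E x / A E \<partial>\<mu>)" for x
  have int1: "(\<integral>\<^sup>+x. w E x / A E \<partial>gaussian_vector) = 1" if "E \<in> space \<mu>" for E
    using that A_pos[OF that] A_fin[of E] by (simp add: nn_integral_divide A_def[symmetric] ennreal_divide_self less_top)
  have W_rot: "W (Q ` E) (Q x)"
    if Q: "orthogonal_transformation Q" "\<And>x. ?\<pi> (Q x) = Q (?\<pi> x)" and W: "W E x" for Q E x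
  proof -
    note lin = orthogonal_transformation_linear[OF Q(1)]
    note nQ = orthogonal_transformation_norm[OF Q(1)]
    obtain y where y: "y \<in> E" "?\<pi> y = y" "norm y = 1" "norm (?\<pi> x - norm (?\<pi> x) *\<^sub>R y) \<le> r * norm (?\<pi> x)"
      using W by (auto simp: W_def)
    have "?\<pi> (Q x) - norm (?\<pi> (Q x)) *\<^sub>R Q y = Q (?\<pi> x - norm (?\<pi> x) *\<^sub>R y)"
      by (simp add: Q(2) nQ linear_diff[OF lin] linear_scale[OF lin])
    then have "norm (?\<pi> (Q x) - norm (?\<pi> (Q x)) *\<^sub>R Q y) \<le> r * norm (?\<pi> (Q x))"
      using y(4) by (simp add: nQ Q(2))
    moreover have "?\<pi> (Q y) = Q y" "norm (Q y) = 1" using y by (simp_all add: Q(2) nQ)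
    moreover have "?\<pi> (Q x) \<noteq> 0" using W nQ[of "?\<pi> x"] by (auto simp: W_def Q(2))
    ultimately show ?thesis using y(1) unfolding W_def by blast
  qed
  \<comment> \<open>Substitute \<open>Q ` E\<close> for \<open>E\<close>: both the kernel and its normalisation \<open>A\<close> are invariant.\<close>
  have D_rot: "D (Q x) = D x"
    if Q: "orthogonal_transformation Q" "\<And>x. Q (Q x) = x" "\<And>x. ?\<pi> (Q x) = Q (?\<pi> x)" for Q x
  proof -
    have QQ: "Q ` Q ` E = E" for E using Q(2) by (auto simp: image_image)
    have wQ: "w (Q ` E) (Q x) = w E x" for E x
      using W_rot[OF Q(1,3), of E x] W_rot[OF Q(1,3), of "Q ` E" "Q x"] by (auto simp: w_simp Q(2) QQ)
    have AQ: "A (Q ` E) = A E" if E: "E \<in> space \<mu>" for E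
    proof -
      have "Q ` E \<in> space \<mu>" using measurable_space[OF grassmann_haar_distr(1)[OF \<mu> Q(1)] E] .
      then have "A (Q ` E) = (\<integral>\<^sup>+x. w (Q ` E) (Q x) \<partial>gaussian_vector)"
        unfolding A_def by (intro nn_integral_gaussian_vector_rotate[symmetric] Q wm2)
      then show ?thesis by (simp add: wQ A_def)
    qed
    have m: "(\<lambda>E. w E (Q x) / A E) \<in> borel_measurable \<mu>"
    proof -
      have "(\<lambda>E. w E (Q x)) \<in> borel_measurable \<mu>"
        using measurable_compose[OF measurable_Pair2'[of "Q x" borel \<mu>] wm] by simp
      then show ?thesis by measurable
    qed
    have "D (Q x) = (\<integral>\<^sup>+E. w E (Q x) / A E \<partial>distr \<mu> \<mu> ((`) Q))"
      by (simp add: D_def grassmann_haar_distr(2)[OF \<mu> Q(1)])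
    also have "\<dots> = (\<integral>\<^sup>+E. w (Q ` E) (Q x) / A (Q ` E) \<partial>\<mu>)"
      by (rule nn_integral_distr[OF grassmann_haar_distr(1)[OF \<mu> Q(1)]]) (use m in simp)
    also have "\<dots> = D x"
      unfolding D_def by (intro nn_integral_cong) (simp add: wQ AQ)
    finally show ?thesis .
  qed
  have D_dir: "D x = D ((1 / norm (?\<pi> x)) *\<^sub>R ?\<pi> x)" if x: "?\<pi> x \<noteq> 0" for x
  proof -
    let ?u = "(1 / norm (?\<pi> x)) *\<^sub>R ?\<pi> x"
    have u: "?\<pi> ?u = ?u" "norm ?u = 1" using x by simp_all
    have "W E x \<longleftrightarrow> W E ?u" for E
    proof -
      have "norm (?\<pi> x - norm (?\<pi> x) *\<^sub>R y) \<le> r * norm (?\<pi> x) \<longleftrightarrow> norm (?u - y) \<le> r" for y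
      proof -
        have "?\<pi> x - norm (?\<pi> x) *\<^sub>R y = norm (?\<pi> x) *\<^sub>R (?u - y)"
          using x by (simp add: scaleR_diff_right)
        then have "norm (?\<pi> x - norm (?\<pi> x) *\<^sub>R y) = norm (?\<pi> x) * norm (?u - y)" by simp
        then show ?thesis using x by (simp add: mult.commute[of r] del: norm_scaleR)
      qed
      then show ?thesis unfolding W_def u using x by auto
    qed
    then show ?thesis by (simp add: D_def w_simp)
  qed
  have D_const: "D x = D x'" if "?\<pi> x \<noteq> 0" "?\<pi> x' \<noteq> 0" for x x'
  proof -
    let ?u = "\<lambda>x. (1 / norm (?\<pi> x)) *\<^sub>R ?\<pi> x"
    have u: "?\<pi> (?u x) = ?u x" "?\<pi> (?u x') = ?u x'" "norm (?u x) = norm (?u x')" using that by simp_all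
    obtain Q where Q: "orthogonal_transformation Q" "Q (?u x) = ?u x'" "\<And>x. Q (Q x) = x"
      "\<And>x. ?\<pi> (Q x) = Q (?\<pi> x)"
      by (rule exists_reflection[OF u]) blast
    have "D (?u x') = D (?u x)" using D_rot[OF Q(1,3,4), of "?u x"] by (simp add: Q(2))
    then show ?thesis using D_dir[OF that(1)] D_dir[OF that(2)] by simp
  qed
  obtain E0 where E0: "E0 \<in> space \<mu>" using \<mu>.not_empty by blast
  then have "subspace E0" "CARD('N) < dim E0 + card J" using J by (simp_all add: space)
  then obtain x0 where "?\<pi> x0 = x0" "norm x0 = 1" by (rule exists_unit_vector_in_section)
  then have x0: "?\<pi> x0 \<noteq> 0" by auto
  define C where "C = D x0"
  have D_eq: "D x = C * indicator {x. ?\<pi> x \<noteq> 0} x" for x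
  proof (cases "?\<pi> x = 0")
    case True
    then have "w E x = 0" for E by (simp add: w_simp W_def)
    then show ?thesis using True by (simp add: D_def)
  qed (use D_const[of x x0] x0 in \<open>auto simp: C_def\<close>)
  have wA[measurable]: "(\<lambda>(E, x). w E x / A E) \<in> borel_measurable (\<mu> \<Otimes>\<^sub>M gaussian_vector)"
  proof -
    have "(\<lambda>z. (case z of (E, x) \<Rightarrow> w E x) / A (fst z)) \<in> borel_measurable (\<mu> \<Otimes>\<^sub>M gaussian_vector)"
      using wmg by measurable
    then show ?thesis by (simp add: case_prod_beta')
  qed
  have proj0: "emeasure gaussian_vector {x. ?\<pi> x \<noteq> 0} = 1"
  proof -
    obtain j where j: "j \<in> J" "x0 $ j \<noteq> 0"
      using x0 by (auto simp: coord_proj_def vec_eq_iff split: if_splits)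
    have "{x. ?\<pi> x = 0} \<subseteq> {x. x $ j = 0}"
    proof
      fix x assume "x \<in> {x. ?\<pi> x = 0}"
      then show "x \<in> {x. x $ j = 0}" using coord_proj_nth[of J x j] j by simp
    qed
    moreover have "{x :: real ^ 'N. x $ j = 0} \<in> sets borel"
      by (intro borel_closed closed_Collect_eq continuous_intros)
    ultimately have "emeasure gaussian_vector {x. ?\<pi> x = 0} = 0"
      using gaussian_vector_coordinate_nonzero[of j] emeasure_mono[of "{x. ?\<pi> x = 0}" "{x. x $ j = 0}" gaussian_vector]
      by simp
    moreover have cl: "{x. ?\<pi> x = 0} \<in> sets borel"
      by (intro borel_closed closed_Collect_eq continuous_intros)
    ultimately have "AE x in gaussian_vector. ?\<pi> x \<noteq> 0"
      by (subst AE_iff_measurable[of "{x. ?\<pi> x = 0}"]) auto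
    then show ?thesis
      using \<gamma>.emeasure_eq_1_AE[of "{x. ?\<pi> x \<noteq> 0}"] cl
      by (simp add: Collect_neg_eq)
  qed
  \<comment> \<open>the total mass of the kernel identifies the constant\<close>
  have "1 = (\<integral>\<^sup>+E. 1 \<partial>\<mu>)" by (simp add: \<mu>.emeasure_space_1)
  also have "\<dots> = (\<integral>\<^sup>+E. \<integral>\<^sup>+x. w E x / A E \<partial>gaussian_vector \<partial>\<mu>)"
    by (intro nn_integral_cong) (simp add: int1)
  also have "\<dots> = (\<integral>\<^sup>+x. D x \<partial>gaussian_vector)"
    unfolding D_def using wA by (rule Fubini'[symmetric])
  also have "\<dots> = C"
    unfolding D_eq using proj0
    by (subst nn_integral_cmult_indicator) (auto intro!: borel_open open_Collect_neq continuous_intros)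
  finally have C: "C = 1" by simp
  have "emeasure \<mu> S = (\<integral>\<^sup>+E. indicator S E \<partial>\<mu>)" using S by simp
  also have "\<dots> = (\<integral>\<^sup>+E. indicator S E * (\<integral>\<^sup>+x. w E x / A E \<partial>gaussian_vector) \<partial>\<mu>)"
    by (intro nn_integral_cong) (simp add: int1)
  also have "\<dots> \<le> (\<integral>\<^sup>+E. \<integral>\<^sup>+x. indicator ?B x * (w E x / A E) \<partial>gaussian_vector \<partial>\<mu>)"
  proof (rule nn_integral_mono)
    fix E assume E: "E \<in> space \<mu>"
    show "indicator S E * (\<integral>\<^sup>+x. w E x / A E \<partial>gaussian_vector) \<le> (\<integral>\<^sup>+x. indicator ?B x * (w E x / A E) \<partial>gaussian_vector)"
    proof (cases "E \<in> S")
      case True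
      have "W E x \<Longrightarrow> x \<in> ?B" for x
      proof -
        assume W: "W E x"
        then obtain y where y: "y \<in> E" "?\<pi> y = y" "norm y = 1" "norm (?\<pi> x - norm (?\<pi> x) *\<^sub>R y) \<le> r * norm (?\<pi> x)"
          and x: "?\<pi> x \<noteq> 0" by (auto simp: W_def)
        have "?\<pi> x - norm (?\<pi> x) *\<^sub>R y = norm (?\<pi> x) *\<^sub>R ((1 / norm (?\<pi> x)) *\<^sub>R ?\<pi> x - y)"
          using x by (simp add: scaleR_diff_right)
        then have "norm (?\<pi> x) * norm ((1 / norm (?\<pi> x)) *\<^sub>R ?\<pi> x - y) \<le> norm (?\<pi> x) * r"
          using y(4) by (simp add: mult.commute)
        then have "norm ((1 / norm (?\<pi> x)) *\<^sub>R ?\<pi> x - y) \<le> r" using x by simp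
        then have "P ((1 / norm (?\<pi> x)) *\<^sub>R ?\<pi> x)"
          using x by (intro near[OF True y(1-3)]) simp_all
        with x show "x \<in> ?B" by simp
      qed
      then have "w E x / A E \<le> indicator ?B x * (w E x / A E)" for x
        by (cases "W E x") (auto simp: w_simp)
      then show ?thesis using True by (auto intro!: nn_integral_mono)
    qed simp
  qed
  also have "\<dots> = (\<integral>\<^sup>+x. \<integral>\<^sup>+E. indicator ?B x * (w E x / A E) \<partial>\<mu> \<partial>gaussian_vector)"
  proof (rule Fubini'[symmetric])
    have [measurable]: "?B \<in> sets gaussian_vector" using B by simp
    have "(\<lambda>z. indicator ?B (snd z) * (case z of (E, x) \<Rightarrow> w E x / A E)) \<in> borel_measurable (\<mu> \<Otimes>\<^sub>M gaussian_vector)"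
      by measurable
    then show "(\<lambda>(E, x). indicator ?B x * (w E x / A E)) \<in> borel_measurable (\<mu> \<Otimes>\<^sub>M gaussian_vector)"
      by (simp add: case_prod_beta')
  qed
  also have "\<dots> = (\<integral>\<^sup>+x. indicator ?B x * D x \<partial>gaussian_vector)"
  proof (intro nn_integral_cong)
    fix x
    have "(\<lambda>E. w E x / A E) \<in> borel_measurable \<mu>"
      using measurable_compose[OF measurable_Pair2'[of x gaussian_vector \<mu>] wA] by simp
    then show "(\<integral>\<^sup>+E. indicator ?B x * (w E x / A E) \<partial>\<mu>) = indicator ?B x * D x"
      unfolding D_def by (rule nn_integral_cmult)
  qed
  also have "\<dots> \<le> (\<integral>\<^sup>+x. indicator ?B x \<partial>gaussian_vector)"
    by (intro nn_integral_mono) (simp add: D_eq C indicator_def)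
  also have "\<dots> = emeasure gaussian_vector ?B" using B by simp
  finally show ?thesis .
qed

section \<open>Random radii of ellipsoids\<close>

lemma section_radius_ge_norm:
  fixes s :: "'N::finite \<Rightarrow> real"
  assumes "1 \<le> p" "\<And>i. 0 \<le> s i" "subspace E" "y \<in> E" "y \<in> p_ellipsoid p s"
  shows "norm y \<le> section_radius E (p_ellipsoid p s)"
  using section_radius_attained[of p s E, OF assms(1-3)] assms(4,5) by auto

text \<open>The radius is attained, so it is at least \<open>c\<close> iff \<open>E\<close> contains a point of the compact set of all
  \<open>y\<close> in the ellipsoid with \<open>norm y \<ge> c\<close>. In terms of the projection matrix this is a closed condition.\<close>

lemma section_radius_ge_measurable:
  fixes s :: "'N::finite \<Rightarrow> real" and \<mu> :: "(real ^ 'N) set measure"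
  assumes p: "1 \<le> p" and s: "\<And>i. 0 \<le> s i" and sets: "sets \<mu> = sets (grassmannian k)"
  shows "{E \<in> space \<mu>. c \<le> section_radius E (p_ellipsoid p s)} \<in> sets \<mu>"
proof -
  have space: "space \<mu> = {E. subspace E \<and> dim E = k}"
    using sets_eq_imp_space_eq[OF sets] by (simp add: space_grassmannian)
  let ?K = "p_ellipsoid p s \<inter> {y. c \<le> norm y}"
  have K: "compact ?K"
    by (intro compact_Int_closed compact_p_ellipsoid p s closed_Collect_le continuous_intros)
  have "closed {w :: (real ^ 'N) \<times> (real ^ 'N ^ 'N). snd w *v fst w = fst w}"
    unfolding matrix_vector_mult_def by (intro closed_Collect_eq continuous_intros)
  from closed_compact_projection[OF K this]
  have C: "{M :: real ^ 'N ^ 'N. \<exists>y. y \<in> ?K \<and> M *v y = y} \<in> sets borel" (is "?C \<in> _") by simp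
  have "(\<lambda>E. matrix (closest_point E)) \<in> borel_measurable \<mu>"
    using measurable_grassmannian_projection[of k] measurable_cong_sets[OF sets refl] by blast
  from measurable_sets[OF this C]
  have "(\<lambda>E. matrix (closest_point E)) -` ?C \<inter> space \<mu> \<in> sets \<mu>" .
  also have "(\<lambda>E. matrix (closest_point E)) -` ?C \<inter> space \<mu> = {E \<in> space \<mu>. c \<le> section_radius E (p_ellipsoid p s)}"
  proof (intro set_eqI iffI)
    fix E assume "E \<in> (\<lambda>E. matrix (closest_point E)) -` ?C \<inter> space \<mu>"
    then obtain y where E: "E \<in> space \<mu>" "subspace E" and y: "y \<in> p_ellipsoid p s" "c \<le> norm y" "y \<in> E"
      by (auto simp: space mem_subspace_iff_projection)
    then show "E \<in> {E \<in> space \<mu>. c \<le> section_radius E (p_ellipsoid p s)}"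
      using section_radius_ge_norm[of p s, OF p s E(2) y(3,1)] by auto
  next
    fix E assume "E \<in> {E \<in> space \<mu>. c \<le> section_radius E (p_ellipsoid p s)}"
    then have E: "E \<in> space \<mu>" "subspace E" "c \<le> section_radius E (p_ellipsoid p s)" by (auto simp: space)
    obtain y where y: "y \<in> E" "y \<in> p_ellipsoid p s" "norm y = section_radius E (p_ellipsoid p s)"
      using section_radius_attained[of p s E, OF p s E(2)] by auto
    then have "matrix (closest_point E) \<in> ?C"
      using E by (auto intro!: exI[of _ y] simp: mem_subspace_iff_projection[OF E(2), symmetric])
    then show "E \<in> (\<lambda>E. matrix (closest_point E)) -` ?C \<inter> space \<mu>" using E(1) by simp
  qed
  finally show ?thesis .
qed

text \<open>Dividing \<open>y\<close> by its weighted norm moves it to the boundary of the ellipsoid. Vanishing semi-axes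
  do no harm, as the coordinates of \<open>y\<close> outside \<open>J\<close> are zero.\<close>

lemma section_radius_ge_inverse_weighted_norm:
  fixes s :: "'N::finite \<Rightarrow> real"
  assumes p: "1 \<le> p" and s: "\<And>i. 0 \<le> s i" and sJ: "\<And>i. i \<in> J \<Longrightarrow> 0 < s i"
    and E: "subspace E" and y: "y \<in> E" "coord_proj J y = y" "norm y = 1"
  shows "0 < weighted_norm p J (\<lambda>i. 1 / s i) (($) y)"
    and "1 \<le> section_radius E (p_ellipsoid p s) * weighted_norm p J (\<lambda>i. 1 / s i) (($) y)"
proof -
  let ?f = "weighted_norm p J (\<lambda>i. 1 / s i) (($) y)"
  have out: "y $ i = 0" if "i \<notin> J" for i using coord_proj_nth[of J y i] that y(2) by simp
  have "y \<noteq> 0" using y(3) by auto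
  then obtain i where i: "y $ i \<noteq> 0" by (auto simp: vec_eq_iff)
  then have iJ: "i \<in> J" using out by blast
  have "0 < (1 / s i * \<bar>y $ i\<bar>) powr p" using i sJ[OF iJ] by simp
  also have "\<dots> \<le> (\<Sum>i\<in>J. (1 / s i * \<bar>y $ i\<bar>) powr p)" using iJ by (intro member_le_sum) auto
  finally have sum: "0 < (\<Sum>i\<in>J. (1 / s i * \<bar>y $ i\<bar>) powr p)" .
  then show f: "0 < ?f" by (simp add: weighted_norm_def)
  let ?z = "(1 / ?f) *\<^sub>R y"
  have "(\<Sum>i\<in>UNIV. (\<bar>?z $ i\<bar> / s i) powr p) = (\<Sum>i\<in>J. (\<bar>?z $ i\<bar> / s i) powr p)"
    using out by (intro sum.mono_neutral_right) auto
  also have "\<dots> = (\<Sum>i\<in>J. (1 / s i * \<bar>y $ i\<bar>) powr p / ?f powr p)"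
  proof (intro sum.cong refl)
    fix i
    have "\<bar>?z $ i\<bar> / s i = (1 / s i * \<bar>y $ i\<bar>) / ?f" using f by (simp add: abs_mult)
    then show "(\<bar>?z $ i\<bar> / s i) powr p = (1 / s i * \<bar>y $ i\<bar>) powr p / ?f powr p"
      by (simp only: powr_divide)
  qed
  also have "\<dots> = 1"
    unfolding sum_divide_distrib[symmetric]
    using p sum weighted_norm_powr[of p J "\<lambda>i. 1 / s i" "($) y"] by simp
  finally have "?z \<in> p_ellipsoid p s"
    using out sJ by (fastforce simp: p_ellipsoid_def)
  then have "norm ?z \<le> section_radius E (p_ellipsoid p s)"
    using E y(1) by (intro section_radius_ge_norm p s) (auto intro: subspace_scale)
  then show "1 \<le> section_radius E (p_ellipsoid p s) * ?f"
    using f y(3) by (simp add: field_simps)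
qed

lemma gaussian_vector_restrict:
  fixes J :: "'N::finite set" and Q :: "('N \<Rightarrow> real) \<Rightarrow> bool"
  assumes Q: "\<And>x. Q (restrict x J) = Q x" and m: "{x \<in> space (gaussian_product J). Q x} \<in> sets (gaussian_product J)"
  shows "emeasure gaussian_vector {x :: real ^ 'N. Q (($) x)} = emeasure (gaussian_product J) {x \<in> space (gaussian_product J). Q x}"
    and "{x :: real ^ 'N. Q (($) x)} \<in> sets borel"
proof -
  interpret product_prob_space "\<lambda>_::'N. std_normal_distribution" UNIV by (rule product_prob_space_gaussian)
  let ?A = "{x \<in> space (gaussian_product J). Q x}"
  have r: "(\<lambda>x. restrict x J) \<in> measurable (gaussian_product UNIV) (gaussian_product J)"
    by (rule measurable_restrict_subset) simp
  have v: "(\<lambda>x :: real ^ 'N. restrict (($) x) J) \<in> measurable borel (gaussian_product J)"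
  proof (rule measurable_restrict)
    fix i assume "i \<in> J"
    have "(\<lambda>x :: real ^ 'N. x $ i) \<in> borel_measurable borel"
      by (intro borel_measurable_continuous_onI continuous_intros)
    then show "(\<lambda>x :: real ^ 'N. x $ i) \<in> measurable borel std_normal_distribution" by simp
  qed
  have "(\<lambda>x :: real ^ 'N. restrict (($) x) J) -` ?A \<inter> space borel = {x. Q (($) x)}"
    using measurable_space[OF v] by (auto simp: Q)
  then show B: "{x :: real ^ 'N. Q (($) x)} \<in> sets borel"
    using measurable_sets[OF v m] by simp
  have vl: "(vec_lambda :: ('N \<Rightarrow> real) \<Rightarrow> real ^ 'N) \<in> measurable (gaussian_product UNIV) borel"
    by (rule measurable_vec_lambda_PiM) simp
  have "emeasure gaussian_vector {x :: real ^ 'N. Q (($) x)}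
      = emeasure (gaussian_product UNIV) (vec_lambda -` {x :: real ^ 'N. Q (($) x)} \<inter> space (gaussian_product UNIV))"
    unfolding gaussian_vector_def by (rule emeasure_distr[OF vl B])
  also have "vec_lambda -` {x :: real ^ 'N. Q (($) x)} \<inter> space (gaussian_product UNIV)
      = (\<lambda>x. restrict x J) -` ?A \<inter> space (gaussian_product UNIV)"
    using measurable_space[OF r] by (auto simp: Q vec_lambda_inverse)
  also have "emeasure (gaussian_product UNIV) \<dots> = emeasure (distr (gaussian_product UNIV) (gaussian_product J) (\<lambda>x. restrict x J)) ?A"
    by (rule emeasure_distr[OF r m, symmetric])
  also have "distr (gaussian_product UNIV) (gaussian_product J) (\<lambda>x. restrict x J) = gaussian_product J"
    by (rule distr_restrict[symmetric]) auto
  finally show "emeasure gaussian_vector {x :: real ^ 'N. Q (($) x)} = emeasure (gaussian_product J) ?A" .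
qed

text \<open>For \<open>c' < c\<close> and a section of radius below \<open>c'\<close>, the weighted norm exceeds \<open>1 / c'\<close> on the unit
  vectors of \<open>E \<inter> F\<close>, where \<open>F\<close> is the subspace of the coordinates in \<open>J\<close>. By Lipschitz continuity it exceeds \<open>1 / c\<close> on a neighbourhood whose size is
  the same for all such \<open>E\<close>. The comparison with a Gaussian vector therefore applies to each
  \<open>c' < c\<close>, and continuity of \<open>\<mu>\<close> from below gives the bound for \<open>c\<close>.\<close>

theorem section_radius_tail:
  fixes s :: "'N::finite \<Rightarrow> real" and \<mu> :: "(real ^ 'N) set measure"
  assumes \<mu>: "grassmann_haar k \<mu>" and k: "CARD('N) = k + n" and n: "1 \<le> n" and J: "card J = n + 1"
    and p: "1 \<le> p" and s: "\<And>i. 0 \<le> s i" and sJ: "\<And>i. i \<in> J \<Longrightarrow> 0 < s i"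
    and L: "\<And>z. weighted_norm p J (\<lambda>i. 1 / s i) z \<le> L * L2_set z J" "0 < L"
    and a: "(\<integral>x. weighted_norm p J (\<lambda>i. 1 / s i) x \<partial>gaussian_product J) \<le> a" and t: "0 < t"
  shows "1 - exp (- real n / 8) - exp (- t\<^sup>2 / 2)
    \<le> measure \<mu> {E \<in> space \<mu>. sqrt (real n) / (2 * (a + t * L)) \<le> section_radius E (p_ellipsoid p s)}"
proof -
  interpret \<mu>: prob_space \<mu> using \<mu> by (simp add: grassmann_haar_def)
  interpret \<gamma>: prob_space "gaussian_vector :: (real ^ 'N) measure" by (rule prob_space_gaussian_vector)
  interpret PJ: product_prob_space "\<lambda>_::'N. std_normal_distribution" J by (rule product_prob_space_gaussian)
  have sets: "sets \<mu> = sets (grassmannian k)" using \<mu> by (simp add: grassmann_haar_def)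
  have space: "space \<mu> = {E. subspace E \<and> dim E = k}"
    using sets_eq_imp_space_eq[OF sets] by (simp add: space_grassmannian)
  have finJ: "finite J" by simp
  note [measurable] = measurable_weighted_norm[OF finJ] measurable_L2_set_gaussian[OF finJ]
  let ?f = "weighted_norm p J (\<lambda>i. 1 / s i)" and ?R = "\<lambda>E. section_radius E (p_ellipsoid p s)"
  define c where "c = sqrt (real n) / (2 * (a + t * L))"
  define \<delta> where "\<delta> = exp (- real n / 8) + exp (- t\<^sup>2 / 2)"
  have "0 \<le> (\<integral>x. ?f x \<partial>gaussian_product J)"
    by (intro Bochner_Integration.integral_nonneg weighted_norm_nonneg)
  then have aL: "a + t * L > 0" using a t L by (simp add: add_nonneg_pos)
  then have c: "c > 0" using n by (simp add: c_def)
  have w: "0 < 1 / s i" if "i \<in> J" for i using sJ[OF that] by simp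
  define Q where "Q x \<longleftrightarrow> L2_set x J < c * ?f x" for x
  have Qm: "{x \<in> space (gaussian_product J). Q x} \<in> sets (gaussian_product J)"
    unfolding Q_def by measurable
  have Qr: "Q (restrict x J) = Q x" for x
    by (simp add: Q_def L2_set_def weighted_norm_def)
  \<comment> \<open>By homogeneity the condition on the direction compares the two norms of \<open>x\<close>; it fails when the projection of \<open>x\<close> is zero.\<close>
  have bad: "{x. coord_proj J x \<noteq> 0 \<and> 1 < c * ?f (($) ((1 / norm (coord_proj J x)) *\<^sub>R coord_proj J x))}
      = {x :: real ^ 'N. Q (($) x)}"
  proof -
    have np: "norm (coord_proj J x) = L2_set (($) x) J" for x
    proof -
      have "(\<Sum>i\<in>UNIV. (coord_proj J x $ i)\<^sup>2) = (\<Sum>i\<in>J. (coord_proj J x $ i)\<^sup>2)"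
        by (intro sum.mono_neutral_right) (auto simp: coord_proj_nth)
      also have "\<dots> = (\<Sum>i\<in>J. (x $ i)\<^sup>2)" by (intro sum.cong) (auto simp: coord_proj_nth)
      finally show ?thesis by (simp add: norm_vec_def L2_set_def)
    qed
    have fp: "?f (($) (coord_proj J x)) = ?f (($) x)" for x
      by (simp add: weighted_norm_def coord_proj_nth)
    have f0: "?f (($) x) = 0" if "coord_proj J x = 0" for x
    proof -
      have "?f (($) (0 :: real ^ 'N)) = 0" using p by (simp add: weighted_norm_def)
      then show ?thesis using fp[of x] that by simp
    qed
    have fs: "?f (($) (r *\<^sub>R x)) = \<bar>r\<bar> * ?f (($) x)" for r and x :: "real ^ 'N"
    proof -
      have "($) (r *\<^sub>R x) = (\<lambda>i. r * x $ i)" by (simp add: fun_eq_iff)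
      then show ?thesis using weighted_norm_scale[of p J "\<lambda>i. 1 / s i" r "($) x"] p by simp
    qed
    have "(coord_proj J x \<noteq> 0 \<and> 1 < c * ?f (($) ((1 / norm (coord_proj J x)) *\<^sub>R coord_proj J x))) \<longleftrightarrow> Q (($) x)" for x
    proof (cases "coord_proj J x = 0")
      case True
      then show ?thesis using np[of x] f0[of x] by (simp add: Q_def)
    next
      case False
      then have pos: "0 < L2_set (($) x) J" using np[of x] by (metis zero_less_norm_iff)
      have "?f (($) ((1 / norm (coord_proj J x)) *\<^sub>R coord_proj J x)) = ?f (($) x) / L2_set (($) x) J"
        unfolding fs fp np using pos by simp
      then show ?thesis using False pos by (simp add: Q_def less_divide_eq)
    qed
    then show ?thesis by blast
  qed
  have tail: "emeasure gaussian_vector {x :: real ^ 'N. Q (($) x)} \<le> ennreal \<delta>"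
  proof -
    have "measure (gaussian_product J) {x \<in> space (gaussian_product J). Q x} \<le> \<delta>"
      unfolding Q_def c_def \<delta>_def by (rule gaussian_ratio_tail[OF finJ J p w L a t])
    then show ?thesis
      unfolding gaussian_vector_restrict(1)[of Q J, OF Qr Qm] by (simp add: PJ.P.emeasure_eq_measure ennreal_leI)
  qed
  have meas: "{E \<in> space \<mu>. c' \<le> ?R E} \<in> sets \<mu>" for c'
    by (rule section_radius_ge_measurable[OF p s sets])
  have meas': "{E \<in> space \<mu>. ?R E < c'} \<in> sets \<mu>" for c'
  proof -
    have "{E \<in> space \<mu>. ?R E < c'} = space \<mu> - {E \<in> space \<mu>. c' \<le> ?R E}" by auto
    then show ?thesis using meas by auto
  qed
  have below: "measure \<mu> {E \<in> space \<mu>. ?R E < c'} \<le> \<delta>" if c': "0 < c'" "c' < c" for c'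
  proof -
    define r where "r = (1 / c' - 1 / c) / L"
    have "1 / c < 1 / c'" using c' by (simp add: field_simps)
    then have r: "0 < r" "L * r = 1 / c' - 1 / c" using L(2) by (auto simp: r_def)
    have "emeasure \<mu> {E \<in> space \<mu>. ?R E < c'} \<le> emeasure gaussian_vector
        {x. coord_proj J x \<noteq> 0 \<and> 1 < c * ?f (($) ((1 / norm (coord_proj J x)) *\<^sub>R coord_proj J x))}"
    proof (rule grassmann_haar_section_le_gaussian[OF \<mu> _ r(1) meas'])
      show "CARD('N) < k + card J" using k J by simp
      show "{x. coord_proj J x \<noteq> 0 \<and> 1 < c * ?f (($) ((1 / norm (coord_proj J x)) *\<^sub>R coord_proj J x))} \<in> sets borel"
        unfolding bad by (rule gaussian_vector_restrict(2)[OF Qr Qm])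
      fix E and y z :: "real ^ 'N"
      assume E: "E \<in> {E \<in> space \<mu>. ?R E < c'}" and y: "y \<in> E" "coord_proj J y = y" "norm y = 1"
        and zy: "norm (z - y) \<le> r"
      have sub: "subspace E" using E space by auto
      note fy = section_radius_ge_inverse_weighted_norm[OF p s sJ sub y]
      have "1 \<le> ?R E * ?f (($) y)" by (rule fy(2))
      also have "\<dots> < c' * ?f (($) y)" using E fy(1) by (intro mult_strict_right_mono) auto
      finally have "1 / c' < ?f (($) y)" using c' by (simp add: field_simps)
      moreover have "?f (($) y) - ?f (($) z) \<le> L * r"
      proof -
        have "\<bar>?f (($) z) - ?f (($) y)\<bar> \<le> L * L2_set (\<lambda>i. z $ i - y $ i) J"
          using w by (intro weighted_norm_lipschitz p L(1)) (auto intro: less_imp_le)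
        also have "L2_set (\<lambda>i. z $ i - y $ i) J \<le> L2_set (\<lambda>i. z $ i - y $ i) UNIV"
          unfolding L2_set_def by (intro real_sqrt_le_mono sum_mono2) auto
        also have "\<dots> = norm (z - y)" by (simp add: norm_vec_def L2_set_def)
        finally have "\<bar>?f (($) z) - ?f (($) y)\<bar> \<le> L * norm (z - y)" using L(2) by simp
        also have "\<dots> \<le> L * r" using zy L(2) by simp
        finally show ?thesis by simp
      qed
      ultimately have "1 / c < ?f (($) z)" using r(2) by linarith
      then show "1 < c * ?f (($) z)" using c by (simp add: field_simps)
    qed
    also have "\<dots> \<le> ennreal \<delta>" unfolding bad by (rule tail)
    finally have "emeasure \<mu> {E \<in> space \<mu>. ?R E < c'} \<le> ennreal \<delta>" .
    then show ?thesis
    proof -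
      have "0 \<le> \<delta>" by (simp add: \<delta>_def)
      with \<open>emeasure \<mu> {E \<in> space \<mu>. ?R E < c'} \<le> ennreal \<delta>\<close> show ?thesis
        by (simp add: \<mu>.emeasure_eq_measure ennreal_le_iff)
    qed
  qed
  define q where "q m = c * (1 - 1 / real (m + 2))" for m
  have q: "0 < q m" "q m < c" for m
  proof -
    have "0 < 1 - 1 / real (m + 2)" "1 - 1 / real (m + 2) < 1" by (simp_all add: field_simps)
    then show "0 < q m" "q m < c" using c by (simp_all only: q_def zero_less_mult_iff mult_less_cancel_left_pos[of c _ 1, simplified]) auto
  qed
  have qlim: "q \<longlonglongrightarrow> c"
  proof -
    have "(\<lambda>m. c * (1 - 1 / real (m + 2))) \<longlonglongrightarrow> c * (1 - 0)"
      by (intro tendsto_intros LIMSEQ_ignore_initial_segment[OF lim_1_over_n])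
    then show ?thesis by (simp add: q_def[abs_def])
  qed
  have "incseq q" using c by (intro incseq_SucI) (simp add: q_def field_simps)
  then have "incseq (\<lambda>m. {E \<in> space \<mu>. ?R E < q m})"
    by (auto simp: incseq_def intro: less_le_trans)
  then have "(\<lambda>m. measure \<mu> {E \<in> space \<mu>. ?R E < q m}) \<longlonglongrightarrow> measure \<mu> (\<Union>m. {E \<in> space \<mu>. ?R E < q m})"
    using meas' by (intro \<mu>.finite_Lim_measure_incseq) auto
  moreover have "(\<Union>m. {E \<in> space \<mu>. ?R E < q m}) = {E \<in> space \<mu>. ?R E < c}"
  proof (intro set_eqI iffI)
    fix E assume E: "E \<in> {E \<in> space \<mu>. ?R E < c}"
    then have "eventually (\<lambda>m. ?R E < q m) sequentially" by (intro order_tendstoD(1)[OF qlim]) simp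
    then obtain m where "?R E < q m" using eventually_happens[of _ sequentially] by auto
    then show "E \<in> (\<Union>m. {E \<in> space \<mu>. ?R E < q m})" using E by auto
  qed (use q(2) in \<open>auto intro: less_trans\<close>)
  ultimately have "measure \<mu> {E \<in> space \<mu>. ?R E < c} \<le> \<delta>"
    using below[OF q] by (intro LIMSEQ_le_const2) auto
  moreover have "measure \<mu> {E \<in> space \<mu>. c \<le> ?R E} = 1 - measure \<mu> {E \<in> space \<mu>. ?R E < c}"
  proof -
    have "{E \<in> space \<mu>. c \<le> ?R E} = space \<mu> - {E \<in> space \<mu>. ?R E < c}" by auto
    then show ?thesis using \<mu>.prob_compl[OF meas'] by simp
  qed
  ultimately show ?thesis by (simp add: c_def \<delta>_def)
qed

lemma epowr_sum_inverse:
  fixes \<sigma> :: "'i \<Rightarrow> real"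
  assumes "\<And>i. i \<in> I \<Longrightarrow> 0 < \<sigma> i"
  shows "(\<Sum>i\<in>I. 1 / ennreal (\<sigma> i powr q)) epowr r = ennreal ((\<Sum>i\<in>I. (1 / \<sigma> i) powr q) powr r)"
proof -
  have "(\<Sum>i\<in>I. 1 / ennreal (\<sigma> i powr q)) = (\<Sum>i\<in>I. ennreal ((1 / \<sigma> i) powr q))"
  proof (intro sum.cong refl)
    fix i assume "i \<in> I"
    then have "0 < \<sigma> i" by (rule assms)
    then show "1 / ennreal (\<sigma> i powr q) = ennreal ((1 / \<sigma> i) powr q)"
      using divide_ennreal[of 1 "\<sigma> i powr q"] by (simp add: powr_divide)
  qed
  also have "\<dots> = ennreal (\<Sum>i\<in>I. (1 / \<sigma> i) powr q)" by (intro sum_ennreal) simp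
  finally show ?thesis by (simp add: ennreal_powr_def sum_nonneg)
qed

theorem corollary3p4:
  fixes n :: nat and p t :: real and \<sigma> :: "nat \<Rightarrow> real"
    and \<iota> :: "'N::finite \<Rightarrow> nat"
    and \<mu> :: "(real ^ 'N) set measure"
  assumes "1 \<le> n" and "n < CARD('N)"
    and "1 \<le> p"
    and "bij_betw \<iota> UNIV {1..CARD('N)}"
    and "\<And>i. i \<in> {1..CARD('N)} \<Longrightarrow> 0 \<le> \<sigma> i"
    and "antimono_on {1..CARD('N)} \<sigma>"
    and "grassmann_haar (CARD('N) - n) \<mu>"
    and "0 < t"
  shows "measure \<mu> {E \<in> space \<mu>.
      (2 \<le> p \<longrightarrow>
        ennreal (section_radius E (p_ellipsoid p (\<lambda>i. \<sigma> (\<iota> i)))) \<ge>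
          ennreal (sqrt (real n)) /
          (2 * (ennreal (sqrt p) * (\<Sum>i=1..n+1. 1 / ennreal (\<sigma> i powr p)) epowr (1 / p)
                + ennreal t / ennreal (\<sigma> (n + 1))))) \<and>
      (p < 2 \<longrightarrow>
        ennreal (section_radius E (p_ellipsoid p (\<lambda>i. \<sigma> (\<iota> i)))) \<ge>
          ennreal (sqrt (real n)) /
          (2 * ((\<Sum>i=1..n+1. 1 / ennreal (\<sigma> i powr p)) epowr (1 / p)
                + ennreal t *
                  (\<Sum>i=1..n+1. 1 / ennreal (\<sigma> i powr (2 * p / (2 - p)))) epowr (1 / p - 1 / 2))))}
    \<ge> 1 - exp (- real n / 8) - exp (- t\<^sup>2 / 2)"
proof -
  note n = assms(1,2) and p = assms(3) and \<iota> = assms(4) and \<sigma>0 = assms(5) and mono = assms(6)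
    and \<mu> = assms(7) and t = assms(8)
  interpret \<mu>: prob_space \<mu> using \<mu> by (simp add: grassmann_haar_def)
  have sets: "sets \<mu> = sets (grassmannian (CARD('N) - n))" using \<mu> by (simp add: grassmann_haar_def)
  have space: "space \<mu> = {E. subspace E \<and> dim E = CARD('N) - n}"
    using sets_eq_imp_space_eq[OF sets] by (simp add: space_grassmannian)
  define s where "s i = \<sigma> (\<iota> i)" for i
  have \<iota>1: "\<iota> i \<in> {1..CARD('N)}" for i using bij_betwE[OF \<iota>] by blast
  have s: "0 \<le> s i" for i unfolding s_def by (rule \<sigma>0) (rule \<iota>1)
  let ?R = "\<lambda>E. section_radius E (p_ellipsoid p s)"
  have R_nonneg: "0 \<le> ?R E" if "E \<in> space \<mu>" for E
    using section_radius_attained[of p s E] that p s by (auto simp: space) (metis norm_ge_zero)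
  let ?S1 = "(\<Sum>i=1..n+1. 1 / ennreal (\<sigma> i powr p)) epowr (1 / p)"
  let ?S2 = "(\<Sum>i=1..n+1. 1 / ennreal (\<sigma> i powr (2 * p / (2 - p)))) epowr (1 / p - 1 / 2)"
  define X where "X = (if 2 \<le> p then ennreal (sqrt p) * ?S1 + ennreal t / ennreal (\<sigma> (n + 1))
    else ?S1 + ennreal t * ?S2)"
  have set_eq: "{E \<in> space \<mu>.
      (2 \<le> p \<longrightarrow> ennreal (?R E) \<ge> ennreal (sqrt (real n)) / (2 * (ennreal (sqrt p) * ?S1 + ennreal t / ennreal (\<sigma> (n + 1))))) \<and>
      (p < 2 \<longrightarrow> ennreal (?R E) \<ge> ennreal (sqrt (real n)) / (2 * (?S1 + ennreal t * ?S2)))}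
    = {E \<in> space \<mu>. ennreal (sqrt (real n)) / (2 * X) \<le> ennreal (?R E)}" (is "?lhs = _")
    by (auto simp: X_def)
  have "1 - exp (- real n / 8) - exp (- t\<^sup>2 / 2) \<le> measure \<mu> {E \<in> space \<mu>. ennreal (sqrt (real n)) / (2 * X) \<le> ennreal (?R E)}"
  proof (cases "\<sigma> (n + 1) = 0")
    case True
    \<comment> \<open>the denominator is infinite and the asserted lower bound is zero\<close>
    have "(\<Sum>i=1..n+1. 1 / ennreal (\<sigma> i powr p)) = \<infinity>"
    proof -
      have "1 / ennreal (\<sigma> (n + 1) powr p) \<le> (\<Sum>i=1..n+1. 1 / ennreal (\<sigma> i powr p))"
        by (intro member_le_sum) auto
      then show ?thesis using True by (simp add: top_unique ennreal_divide_zero)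
    qed
    then have "?S1 = \<infinity>" by (simp add: ennreal_powr_def)
    then have "X = \<infinity>" using p by (simp add: X_def ennreal_mult_top)
    then have "{E \<in> space \<mu>. ennreal (sqrt (real n)) / (2 * X) \<le> ennreal (?R E)} = space \<mu>"
      by (simp add: ennreal_mult_top)
    moreover have "1 - exp (- real n / 8) - exp (- t\<^sup>2 / 2) \<le> 1"
      using exp_ge_zero[of "- real n / 8"] exp_ge_zero[of "- t\<^sup>2 / 2"] by linarith
    ultimately show ?thesis by (simp only: \<mu>.prob_space)
  next
    case False
    have \<sigma>pos: "0 < \<sigma> i" if i: "i \<in> {1..n+1}" for i
    proof -
      have "\<sigma> (n + 1) \<le> \<sigma> i"
        using i n by (intro monotone_onD[OF mono]) auto
      moreover have "0 \<le> \<sigma> (n + 1)" using n by (intro \<sigma>0) auto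
      ultimately show ?thesis using False by linarith
    qed
    define J where "J = \<iota> -` {1..n+1}"
    have bij: "bij_betw \<iota> J {1..n+1}"
      unfolding J_def using n by (intro bij_betw_subset[OF \<iota>]) (use \<iota> in \<open>auto simp: bij_betw_def\<close>)
    have cardJ: "card J = n + 1" using bij_betw_same_card[OF bij] by simp
    have J: "finite J" "J \<noteq> {}" using cardJ by auto
    have sJ: "0 < s i" if "i \<in> J" for i using that \<sigma>pos by (auto simp: J_def s_def)
    have sums: "(\<Sum>i\<in>J. (1 / s i) powr q) = (\<Sum>i=1..n+1. (1 / \<sigma> i) powr q)" for q
      unfolding s_def using sum.reindex_bij_betw[OF bij, of "\<lambda>i. (1 / \<sigma> i) powr q"] .
    have w: "0 < 1 / s i" if "i \<in> J" for i using sJ[OF that] by simp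
    let ?T1 = "(\<Sum>i=1..n+1. (1 / \<sigma> i) powr p) powr (1 / p)"
    let ?T2 = "(\<Sum>i=1..n+1. (1 / \<sigma> i) powr (2 * p / (2 - p))) powr (1 / p - 1 / 2)"
    have S: "?S1 = ennreal ?T1" "?S2 = ennreal ?T2"
      by (intro epowr_sum_inverse \<sigma>pos; assumption)+
    have pos: "0 < (\<Sum>i=1..n+1. (1 / \<sigma> i) powr q)" for q
    proof (rule sum_pos)
      show "0 < (1 / \<sigma> i) powr q" if "i \<in> {1..n+1}" for i using \<sigma>pos[OF that] by simp
    qed auto
    define L where "L = (if 2 \<le> p then 1 / \<sigma> (n + 1) else ?T2)"
    define m where "m = (if 2 \<le> p then sqrt p else 1)"
    have m: "0 < m" using p by (simp add: m_def)
    have "0 < ?T2" by (subst powr_gt_zero) (rule less_imp_neq[OF pos, symmetric])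
    then have L0: "0 < L" using \<sigma>pos[of "n + 1"] by (simp only: L_def split: if_split) simp
    have lip: "weighted_norm p J (\<lambda>i. 1 / s i) z \<le> L * L2_set z J" for z
    proof (cases "2 \<le> p")
      case True
      have "0 \<le> 1 / s i \<and> 1 / s i \<le> 1 / \<sigma> (n + 1)" if i: "i \<in> J" for i
      proof -
        have "\<sigma> (n + 1) \<le> s i"
          using i n unfolding s_def by (intro monotone_onD[OF mono]) (auto simp: J_def)
        then show ?thesis using \<sigma>pos[of "n + 1"] sJ[OF i] by (simp add: frac_le)
      qed
      moreover have "L = 1 / \<sigma> (n + 1)" using True by (simp add: L_def)
      ultimately show ?thesis using weighted_norm_le_L2_ge2[OF J(1) True, of "\<lambda>i. 1 / s i" L z] by simp
    next
      case False
      then show ?thesis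
        using weighted_norm_le_L2_less2[of J p "\<lambda>i. 1 / s i" z, OF J p _ w] by (simp add: L_def sums)
    qed
    have mean: "(\<integral>x. weighted_norm p J (\<lambda>i. 1 / s i) x \<partial>gaussian_product J) \<le> m * ?T1"
    proof -
      have "integrable std_normal_distribution (\<lambda>x. \<bar>x\<bar> powr p)
        \<and> (\<integral>x. \<bar>x\<bar> powr p \<partial>std_normal_distribution) \<le> m powr p"
      proof (cases "2 \<le> p")
        case True
        have "sqrt p powr p = p powr (p / 2)"
          using p by (simp add: powr_half_sqrt[symmetric] powr_powr)
        then show ?thesis using True std_normal_abs_moment_le_powr[OF True] by (simp add: m_def)
      next
        case False
        then show ?thesis using std_normal_abs_moment_le_1[OF p] by (simp add: m_def)
      qed
      then show ?thesis
        using weighted_norm_expectation_le[of J p "\<lambda>i. 1 / s i" m, OF J p w _ _ m] by (simp add: sums)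
    qed
    have ennreal_lincomb: "ennreal a * ennreal b + ennreal c * ennreal d = ennreal (a * b + c * d)"
      if "0 \<le> a" "0 \<le> b" "0 \<le> c" "0 \<le> d" for a b c d :: real
      using that by (simp add: ennreal_mult)
    have X: "X = ennreal (m * ?T1 + t * L)"
    proof (cases "2 \<le> p")
      case True
      have "ennreal t / ennreal (\<sigma> (n + 1)) = ennreal t * ennreal (1 / \<sigma> (n + 1))"
        using t \<sigma>pos[of "n + 1"] divide_ennreal[of t "\<sigma> (n + 1)"] by (simp add: ennreal_mult'[symmetric])
      then have "X = ennreal m * ennreal ?T1 + ennreal t * ennreal L"
        using True by (simp only: X_def S m_def L_def if_True)
      then show ?thesis
        using m t L0 by (simp only: ennreal_lincomb[OF less_imp_le powr_ge_zero less_imp_le less_imp_le])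
    next
      case False
      then have "X = ennreal m * ennreal ?T1 + ennreal t * ennreal L"
        by (simp only: X_def S m_def L_def if_False ennreal_1 mult_1_left)
      then show ?thesis
        using m t L0 by (simp only: ennreal_lincomb[OF less_imp_le powr_ge_zero less_imp_le less_imp_le])
    qed
    have "0 < m * ?T1 + t * L"
      using m pos L0 t by (intro add_nonneg_pos mult_pos_pos) auto
    then have "ennreal (sqrt (real n)) / (2 * X) = ennreal (sqrt (real n) / (2 * (m * ?T1 + t * L)))"
      unfolding X using divide_ennreal[of "sqrt (real n)" "2 * (m * ?T1 + t * L)"] ennreal_mult'[of 2 "m * ?T1 + t * L"]
      by simp
    then have "{E \<in> space \<mu>. ennreal (sqrt (real n)) / (2 * X) \<le> ennreal (?R E)}
        = {E \<in> space \<mu>. sqrt (real n) / (2 * (m * ?T1 + t * L)) \<le> ?R E}"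
      using R_nonneg by (auto simp: ennreal_le_iff)
    then show ?thesis
      using section_radius_tail[OF \<mu> _ n(1) cardJ p s sJ lip L0 mean t] n(2) by simp
  qed
  then show ?thesis unfolding set_eq[symmetric] s_def[symmetric] by (simp add: s_def[abs_def])
qed

end
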